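(* Let $n>2$ be an integer, $A=A_n(\mathbf{R})$ and $B=B_n(\mathbf{R})$. Then: (a) $B$ is characteristic in $A$, so that restriction to $B$ gives a homomorphism from $\mathrm{Aut}(A)$ to $\mathrm{Aut}(B)$. (b) This homomorphism from $\mathrm{Aut}(A)$ to $\mathrm{Aut}(B)$ is a monomorphism, so that $\mathrm{Aut}(A)$ can be regarded as a subgroup of $\mathrm{Aut}(B)$. (c) The index of $B$ in $A$ is finite. (d) The index of $\mathrm{Aut}(A)$ in $\mathrm{Aut}(B)$ is infinite.
   Context: Functions are written to the right of their arguments and composed from left to right. For an integer $n\ge 2$: $\mathbf{Z}[\frac1n]=\{an^b : a,b\in\mathbf{Z}\}$ and $\langle n\rangle=\{n^k : k\in\mathbf{Z}\}$. A break of a piecewise linear (PL) function is a point where its derivative is discontinuous. $A_n(\mathbf{R})$ is the group of all homeomorphisms $h:\mathbf{R}\to\mathbf{R}$ such that (1) $h$ preserves orientation, (2) $h$ is PL, (3) all slopes of $h$ are in $\langle n\rangle$, (4) the breaks of $h$ lie in a discrete subset of $\mathbf{Z}[\frac1n]$, (5) $(\mathbf{Z}[\frac1n])h=\mathbf{Z}[\frac1n]$. Let $\phi_n:\mathbf{Z}[\frac1n]\to\mathbf{Z}_{n-1}=\mathbf{Z}/(n-1)\mathbf{Z}$ be the well-defined surjective ring homomorphism $(an^b)\phi_n=a\pmod{n-1}$. There is a well-defined homomorphism $\rho_n:A_n(\mathbf{R})\to\mathbf{Z}_{n-1}$, $f\rho_n=(xf)\phi_n-x\phi_n$ for any $x\in\mathbf{Z}[\frac1n]$,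 and $B_n(\mathbf{R})=\ker\rho_n$. *)

theory Defs
  imports
    "HOL-Analysis.Analysis"
    "HOL-Algebra.Bij"
    "HOL-Algebra.Elementary_Groups"
begin

definition Z_inv :: "nat \<Rightarrow> real set" where
  "Z_inv n = {of_int a * real n powi b | a b :: int. True}"

definition slope_group :: "nat \<Rightarrow> real set" where
  "slope_group n = {real n powi k | k :: int. True}"

text \<open>
  The exceptional set \<open>S\<close> has no accumulation point in \<open>\<real>\<close>, so every bounded interval
  meets only finitely many affine pieces.
\<close>

definition piecewise_linear :: "(real \<Rightarrow> real) \<Rightarrow> bool" where
  "piecewise_linear h \<longleftrightarrow> continuous_on UNIV h \<and>
     (\<exists>S. closed S \<and> discrete S \<and>
        (\<forall>u v. {u<..<v} \<inter> S = {} \<longrightarrow> (\<exists>m c. \<forall>x\<in>{u<..<v}. h x = m * x + c)))"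

text \<open>
  \<^term>\<open>deriv h y\<close> is an arbitrary value where \<open>h\<close> is not differentiable; hence the explicit
  requirement that \<open>h\<close> be differentiable near \<open>x\<close>.
\<close>

definition breaks :: "(real \<Rightarrow> real) \<Rightarrow> real set" where
  "breaks h = {x. \<not> ((\<forall>\<^sub>F y in nhds x. h differentiable (at y)) \<and> isCont (deriv h) x)}"

definition A_carrier :: "nat \<Rightarrow> (real \<Rightarrow> real) set" where
  "A_carrier n = {h. (\<exists>g. homeomorphism UNIV UNIV h g)
     \<and> strict_mono h
     \<and> piecewise_linear h
     \<and> (\<forall>x D. (h has_real_derivative D) (at x) \<longrightarrow> D \<in> slope_group n)
     \<and> (\<exists>S \<subseteq> Z_inv n. discrete S \<and> breaks h \<subseteq> S)
     \<and> h ` Z_inv n = Z_inv n}"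

text \<open>Functions act on the right: the product \<open>f g\<close> means first \<open>f\<close>, then \<open>g\<close>.\<close>

definition A_group :: "nat \<Rightarrow> (real \<Rightarrow> real) monoid" where
  "A_group n = \<lparr>carrier = A_carrier n, mult = (\<lambda>f g. g \<circ> f), one = id\<rparr>"

definition phi :: "nat \<Rightarrow> real \<Rightarrow> int" where
  "phi n x = (THE r. \<exists>a b :: int. x = of_int a * real n powi b \<and> r = a mod int (n - 1))"

lemma phi_welldef_aux:
  fixes a a' b b' :: int
  assumes "n \<ge> 2" "b \<le> b'" "of_int a * real n powi b = of_int a' * real n powi b'"
  shows "a mod int (n - 1) = a' mod int (n - 1)"
proof -
  define k where "k = nat (b' - b)"
  have n0: "real n \<noteq> 0"
    using assms(1) by simp
  have "b' = b + int k"
    using assms(2) by (simp add: k_def)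
  then have "real n powi b' = real n powi b * real n ^ k"
    using power_int_add[of "real n" b "int k"] n0 by (simp add: power_int_of_nat)
  then have "real n powi b * of_int a = real n powi b * (of_int a' * real n ^ k)"
    using assms(3) by (metis mult.commute mult.left_commute)
  moreover have "real n powi b \<noteq> 0"
    using n0 by (simp add: power_int_not_zero)
  ultimately have "of_int a = of_int a' * real n ^ k"
    by (metis mult_left_cancel)
  also have "\<dots> = of_int (a' * int n ^ k)"
    by simp
  finally have a: "a = a' * int n ^ k"
    by (simp only: of_int_eq_iff)
  have "int n mod int (n - 1) = 1 mod int (n - 1)"
    using assms(1) by (simp add: mod_eq_dvd_iff of_nat_diff)
  then have "int n ^ k mod int (n - 1) = 1 mod int (n - 1)"
    by (metis power_mod power_one)
  then show ?thesis
    unfolding a by (metis mod_mult_right_eq mult.right_neutral)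
qed

lemma phi_eq:
  fixes a b :: int
  assumes "n \<ge> 2"
  shows "phi n (of_int a * real n powi b) = a mod int (n - 1)"
  unfolding phi_def
proof (rule the_equality)
  fix r
  assume "\<exists>a' b'. of_int a * real n powi b = of_int a' * real n powi b' \<and> r = a' mod int (n - 1)"
  then obtain a' b' where "of_int a * real n powi b = of_int a' * real n powi b'"
    and "r = a' mod int (n - 1)"
    by blast
  then show "r = a mod int (n - 1)"
    using phi_welldef_aux[OF assms, of b b' a a'] phi_welldef_aux[OF assms, of b' b a' a]
    by (cases "b \<le> b'") auto
qed blast

definition rho :: "nat \<Rightarrow> (real \<Rightarrow> real) \<Rightarrow> int" where
  "rho n f = (THE r. \<forall>x\<in>Z_inv n. r = (phi n (f x) - phi n x) mod int (n - 1))"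

definition B_carrier :: "nat \<Rightarrow> (real \<Rightarrow> real) set" where
  "B_carrier n = kernel (A_group n) (integer_mod_group (n - 1)) (rho n)"

definition B_group :: "nat \<Rightarrow> (real \<Rightarrow> real) monoid" where
  "B_group n = (A_group n)\<lparr>carrier := B_carrier n\<rparr>"

definition characteristic_subgroup :: "'a set \<Rightarrow> ('a, 'b) monoid_scheme \<Rightarrow> bool" where
  "characteristic_subgroup H G \<longleftrightarrow> subgroup H G \<and> (\<forall>\<alpha>\<in>auto G. \<alpha> ` H = H)"

text \<open>
  \<^const>\<open>AutoGroup\<close> consists of the automorphisms extensional on the carrier, hence \<open>restrict\<close>.
  Its product composes from right to left, opposite to \<^const>\<open>A_group\<close>. Passing to the opposite
  group changes neither homomorphisms nor indices.
\<close>

definition restr_aut :: "nat \<Rightarrow> ((real \<Rightarrow> real) \<Rightarrow> real \<Rightarrow> real) \<Rightarrow> (real \<Rightarrow> real) \<Rightarrow> real \<Rightarrow> real" where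
  "restr_aut n \<alpha> = restrict \<alpha> (B_carrier n)"

end

theory Submission
  imports Defs
begin

text \<open>
  The proof works throughout with the description of \<open>A = A_n(\<real>)\<close> by germs: an increasing
  bijection \<open>h\<close> of the line belongs to \<open>A\<close> iff it preserves membership in \<open>Z[1/n]\<close> and is, on either side of
  each point, of the form \<open>x \<mapsto> n\<^sup>k x + c\<close>, with the same formula on both sides at points outside
  \<open>Z[1/n]\<close> (\<open>A_carrier_affine_germs\<close>, \<open>A_carrierI\<close>). Membership is therefore a local matter (\<open>A_locally\<close>), and
  infinitely many elements of \<open>A\<close> may be glued along a grid (\<open>glue_grid\<close>).

  Index of \<open>B\<close>. Since \<open>n \<equiv> 1\<close> modulo \<open>n - 1\<close>, an affine piece \<open>x \<mapsto> n\<^sup>k x + c\<close> displaces all points of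
  \<open>Z[1/n]\<close> by the same amount modulo \<open>n - 1\<close>; this makes \<open>\<rho>\<close> a homomorphism into a finite group, with kernel \<open>B\<close>.

  Why \<open>B\<close> is characteristic. Two elements of \<open>A\<close> with displacement divisible by \<open>n - 1\<close> at \<open>0\<close> that move every point to the
  right are conjugate in \<open>A\<close>: both are conjugate to \<open>x \<mapsto> x + (n - 1)\<close>, because a map between fundamental
  intervals extends equivariantly and infinitely many breaks are permitted (\<open>conj_to_translation\<close>). Given \<open>f \<in> B\<close>
  there is \<open>p \<in> B\<close> so large that both \<open>p\<close> and \<open>p \<circ> f\<close> move every point to the right. Being conjugate, they
  differ by a commutator, so \<open>f\<close> is a commutator of elements of \<open>A\<close> (\<open>B_commutator\<close>). As \<open>A / B\<close> is abelian, \<open>B\<close> is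
  exactly the set of commutators, which every automorphism preserves.

  Why restriction is injective. Elements of \<open>B\<close> with small support separate the points of the line, so only the identity
  commutes with all of \<open>B\<close>, and an element of \<open>A\<close> is determined by the way in which it conjugates \<open>B\<close>.

  Why the index of the automorphism groups is infinite. Call the interval \<open>[m, m + 1]\<close> and its images under \<open>B\<close> of type
  \<open>m\<close> modulo \<open>n - 1\<close>. Cutting \<open>[m, m + 1]\<close> into \<open>n\<close> equal parts gives intervals of types
  \<open>m, m + 1, \<dots>, m\<close>, and \<open>B\<close> preserves types, whereas \<open>A\<close> permutes them cyclically. A homeomorphism that treats the
  types differently can therefore normalise \<open>B\<close> without normalising \<open>A\<close>. Such a map, \<open>exotic\<close>, is obtained from a bump
  \<open>b\<close> on the interval \<open>[1, 2]\<close> of type 1 by inserting a copy of \<open>b\<close> into the second part of every interval of type 0, at all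
  scales simultaneously. Formally it is the semiconjugacy from \<open>x \<mapsto> \<gamma>(n x)\<close> to \<open>x \<mapsto> n x\<close>, where
  \<open>\<gamma>\<close> (\<open>twist\<close>) is the periodic extension of \<open>b\<close>. The bump is built from the dilations by \<open>n\<close> at the two ends of
  \<open>[1, 2]\<close>, with which \<open>exotic\<close> commutes there; hence \<open>exotic\<close> commutes with \<open>\<gamma>\<close> (\<open>exotic_twist\<close>), so it
  conjugates \<open>x \<mapsto> n x\<close> to \<open>\<gamma>\<^sup>-\<^sup>1 \<circ> (x \<mapsto> n x)\<close>. This puts the conjugates of the maps
  \<open>x \<mapsto> n x\<close> and \<open>x \<mapsto> x + (n - 1)\<close>, which generate all affine pieces of elements of \<open>B\<close>, back into \<open>B\<close>, and
  \<open>exotic\<close> normalises \<open>B\<close> (\<open>exotic_conj_in_B\<close>). If conjugation by the \<open>m\<close>-th power of \<open>exotic\<close> extended to \<open>A\<close>, that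
  power would have to conjugate \<open>x \<mapsto> x + 1\<close> into \<open>A\<close>; self-similarity at the integers then forces it to commute with
  \<open>x \<mapsto> x + 1\<close>, and consequently \<open>\<gamma>\<^sup>m\<close> to commute with \<open>x \<mapsto> x + n\<close>. But \<open>\<gamma>\<close> moves
  points of \<open>(1, 2)\<close> and fixes \<open>(n + 1, n + 2)\<close>, so \<open>m = 0\<close>. The powers of this one automorphism of \<open>B\<close> thus lie in
  pairwise different cosets.
\<close>

section \<open>Increasing bijections of the line\<close>

lemma strict_mono_surj_at_right:
  fixes h :: "real \<Rightarrow> real"
  assumes "strict_mono h" "surj h"
  shows "filterlim h (at_right (h x)) (at_right x)"
  unfolding filterlim_iff
proof (intro allI impI)
  fix P assume "\<forall>\<^sub>F y in at_right (h x). P y"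
  then obtain b where b: "b > h x" "\<forall>y>h x. y < b \<longrightarrow> P y"
    by (auto simp: eventually_at_right_field)
  moreover obtain c where c: "b = h c"
    using assms(2) by (rule surjE)
  ultimately show "\<forall>\<^sub>F y in at_right x. P (h y)"
    unfolding eventually_at_right_field using strict_mono_less[OF assms(1)]
    by (intro exI[of _ c]) simp
qed

lemma strict_mono_surj_at_left:
  fixes h :: "real \<Rightarrow> real"
  assumes "strict_mono h" "surj h"
  shows "filterlim h (at_left (h x)) (at_left x)"
  unfolding filterlim_iff
proof (intro allI impI)
  fix P assume "\<forall>\<^sub>F y in at_left (h x). P y"
  then obtain b where b: "b < h x" "\<forall>y>b. y < h x \<longrightarrow> P y"
    by (auto simp: eventually_at_left_field)
  moreover obtain c where c: "b = h c"
    using assms(2) by (rule surjE)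
  ultimately show "\<forall>\<^sub>F y in at_left x. P (h y)"
    unfolding eventually_at_left_field using strict_mono_less[OF assms(1)]
    by (intro exI[of _ c]) simp
qed

lemma strict_mono_surj_continuous:
  fixes h :: "real \<Rightarrow> real"
  assumes "strict_mono h" "surj h"
  shows "continuous_on UNIV h"
proof -
  have "(h \<longlongrightarrow> h x) (at_right x)" "(h \<longlongrightarrow> h x) (at_left x)" for x
    using strict_mono_surj_at_right[OF assms, of x] strict_mono_surj_at_left[OF assms, of x]
    by (auto simp: filterlim_at)
  then show ?thesis
    by (auto intro!: continuous_at_imp_continuous_on simp: isCont_def filterlim_at_split)
qed

lemma strict_mono_inv:
  fixes h :: "real \<Rightarrow> real"
  assumes "strict_mono h" "surj h"
  shows "strict_mono (inv_into UNIV h)" "surj (inv_into UNIV h)"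
proof -
  show "strict_mono (inv_into UNIV h)"
  proof (rule strict_monoI)
    fix x y :: real
    assume "x < y"
    then have "h (inv_into UNIV h x) < h (inv_into UNIV h y)"
      using assms(2) by (simp add: surj_f_inv_f)
    then show "inv_into UNIV h x < inv_into UNIV h y"
      using strict_mono_less[OF assms(1)] by simp
  qed
  show "surj (inv_into UNIV h)"
    using assms by (simp add: inj_imp_surj_inv strict_mono_imp_inj_on)
qed

section \<open>The n-adic rationals modulo n - 1\<close>

text \<open>The kernel of the ring homomorphism \<open>\<phi>_n\<close>; congruence of elements of \<open>Z[1/n]\<close> modulo this ideal replaces
  the values of \<open>phi\<close>.\<close>

definition Z_ideal :: "nat \<Rightarrow> real set" where
  "Z_ideal n = {real (n - 1) * x | x. x \<in> Z_inv n}"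

context
  fixes n :: nat
  assumes n2: "n > 2"
begin

abbreviation Z where "Z \<equiv> Z_inv n"
abbreviation I where "I \<equiv> Z_ideal n"
abbreviation A where "A \<equiv> A_carrier n"
abbreviation B where "B \<equiv> B_carrier n"
abbreviation N where "N \<equiv> real n"
abbreviation inver where "inver f \<equiv> inv_into UNIV (f :: real \<Rightarrow> real)"

lemma powi_pos [simp]: "0 < real n powi k"
  using n2 by (simp add: zero_less_power_int)

lemma powi_add: "real n powi (k + l) = real n powi k * real n powi l"
  using n2 by (simp add: power_int_add)

lemma powi_minus_cancel [simp]: "real n powi (- k) * (real n powi k * x) = x"
  "real n powi k * (real n powi (- k) * x) = x"
  using n2 by (simp_all add: power_int_minus)

lemma Z_invI: "of_int a * real n powi b \<in> Z"
  by (auto simp: Z_inv_def)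

lemma Z_common_exponent:
  assumes "x \<in> Z" "y \<in> Z"
  obtains a b e where "x = of_int a * real n powi e" "y = of_int b * real n powi e"
proof -
  have refine: "\<exists>c. of_int a * real n powi e' = of_int c * real n powi e"
    if "e \<le> e'" for a :: int and e e' :: int
  proof -
    have "e' = int (nat (e' - e)) + e"
      using that by simp
    then have "real n powi e' = real n ^ nat (e' - e) * real n powi e"
      by (metis powi_add power_int_of_nat)
    then show ?thesis
      by (intro exI[of _ "a * int n ^ nat (e' - e)"]) simp
  qed
  obtain a e b e' where xy: "x = of_int a * real n powi e" "y = of_int b * real n powi e'"
    using assms by (auto simp: Z_inv_def)
  show thesis
    using refine[of "min e e'" e a] refine[of "min e e'" e' b] xy that by auto
qed

lemma Z_of_int [simp]: "of_int a \<in> Z"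
  using Z_invI[of a 0] by simp

lemma Z_of_nat [simp]: "real a \<in> Z"
  using Z_of_int[of "int a"] by simp

lemma Z_numeral [simp]: "0 \<in> Z" "1 \<in> Z" "numeral w \<in> Z"
  using Z_of_int[of 0] Z_of_int[of 1] Z_of_int[of "numeral w"] by simp_all

lemma Z_powi [simp]: "real n powi k \<in> Z"
  using Z_invI[of 1 k] by simp

lemma Z_add [intro]: "x \<in> Z \<Longrightarrow> y \<in> Z \<Longrightarrow> x + y \<in> Z"
proof -
  assume "x \<in> Z" "y \<in> Z"
  then obtain a b e where "x = of_int a * real n powi e" "y = of_int b * real n powi e"
    by (rule Z_common_exponent)
  then have "x + y = of_int (a + b) * real n powi e"
    by (simp add: distrib_right)
  then show "x + y \<in> Z"
    using Z_invI by metis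
qed

lemma Z_mult [intro]: "x \<in> Z \<Longrightarrow> y \<in> Z \<Longrightarrow> x * y \<in> Z"
proof -
  assume "x \<in> Z" "y \<in> Z"
  then obtain a b e where "x = of_int a * real n powi e" "y = of_int b * real n powi e"
    by (rule Z_common_exponent)
  then have "x * y = of_int (a * b) * real n powi (e + e)"
    by (simp only: powi_add of_int_mult) (simp only: mult_ac)
  then show "x * y \<in> Z"
    using Z_invI by metis
qed

lemma Z_uminus [intro]: "x \<in> Z \<Longrightarrow> - x \<in> Z"
proof -
  assume "x \<in> Z"
  then have "of_int (- 1) * x \<in> Z"
    by (intro Z_mult Z_of_int)
  then show ?thesis by simp
qed

lemma Z_diff [intro]: "x \<in> Z \<Longrightarrow> y \<in> Z \<Longrightarrow> x - y \<in> Z"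
  using Z_add[of x "- y"] Z_uminus[of y] by simp

lemma Z_powi_mult_iff [simp]: "real n powi k * x \<in> Z \<longleftrightarrow> x \<in> Z"
  using Z_mult[OF Z_powi, of x k] Z_mult[OF Z_powi, of "real n powi k * x" "- k"]
  by (auto simp only: powi_minus_cancel)

lemma Z_add_iff: "c \<in> Z \<Longrightarrow> x + c \<in> Z \<longleftrightarrow> x \<in> Z"
  using Z_add[of x c] Z_diff[of "x + c" c] by auto

lemma Z_divide_n [simp]: "x / real n \<in> Z \<longleftrightarrow> x \<in> Z"
  using Z_powi_mult_iff[of "-1" x] by (simp add: power_int_minus field_simps)

lemma Z_mult_n [simp]: "real n * x \<in> Z \<longleftrightarrow> x \<in> Z"
  using Z_powi_mult_iff[of 1 x] by simp

lemma powi_small: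
  assumes "e > 0"
  obtains k where "real n powi k < e"
proof -
  obtain m where "(1 / real n) ^ m < e"
    using real_arch_pow_inv[of e "1 / real n"] assms n2 by auto
  then show thesis
    using that[of "- int m"] by (simp add: power_int_minus power_one_over field_simps)
qed

lemma I_subset_Z: "x \<in> I \<Longrightarrow> x \<in> Z"
  unfolding Z_ideal_def using Z_mult Z_of_nat by blast

lemma I_0 [simp]: "0 \<in> I"
  unfolding Z_ideal_def using Z_numeral(1) by force

lemma I_multI [intro]: "x \<in> Z \<Longrightarrow> real (n - 1) * x \<in> I" "x \<in> Z \<Longrightarrow> x * real (n - 1) \<in> I"
  by (auto simp: Z_ideal_def mult.commute)

lemma I_add [intro]: "x \<in> I \<Longrightarrow> y \<in> I \<Longrightarrow> x + y \<in> I"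
proof -
  assume "x \<in> I" "y \<in> I"
  then obtain u v where "u \<in> Z" "v \<in> Z" "x = real (n - 1) * u" "y = real (n - 1) * v"
    by (auto simp: Z_ideal_def)
  then show ?thesis
    using I_multI(1)[OF Z_add] by (simp add: distrib_left)
qed

lemma I_mult [intro]: "x \<in> Z \<Longrightarrow> y \<in> I \<Longrightarrow> x * y \<in> I"
proof -
  assume "x \<in> Z" "y \<in> I"
  then obtain v where "v \<in> Z" "y = real (n - 1) * v"
    by (auto simp: Z_ideal_def)
  then show ?thesis
    using I_multI(1)[OF Z_mult[of x v]] \<open>x \<in> Z\<close> by (simp add: mult.left_commute)
qed

lemma I_uminus [intro]: "x \<in> I \<Longrightarrow> - x \<in> I"
  using I_mult[OF Z_of_int[of "-1"], of x] by simp

lemma I_diff [intro]: "x \<in> I \<Longrightarrow> y \<in> I \<Longrightarrow> x - y \<in> I"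
  using I_add[of x "- y"] I_uminus[of y] by simp

text \<open>\<open>n \<equiv> 1\<close> modulo \<open>n - 1\<close>, hence multiplication by a slope does not change residues.\<close>

lemma powi_minus_1_mult_I:
  assumes "x \<in> Z"
  shows "(real n powi k - 1) * x \<in> I"
proof -
  have pow: "real n ^ m - 1 \<in> I" for m
  proof (induction m)
    case (Suc m)
    have "real n ^ Suc m - 1 = real (n - 1) * real n ^ m + (real n ^ m - 1)"
      using n2 by (simp add: of_nat_diff algebra_simps)
    moreover have "real (n - 1) * real n ^ m \<in> I"
      using Z_powi[of "int m"] by (intro I_multI) (simp add: power_int_of_nat)
    ultimately show ?case
      using Suc I_add by metis
  qed simp
  have "real n powi k - 1 \<in> I"
  proof (cases "k \<ge> 0")
    case True
    then show ?thesis
      using pow[of "nat k"] by (simp add: power_int_def)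
  next
    case False
    have "real n powi k - 1 = - (real n powi k * (real n ^ nat (- k) - 1))"
    proof -
      have "real n powi k * real n ^ nat (- k) = real n powi k * real n powi (- k)"
        using False by (simp add: power_int_def)
      also have "\<dots> = 1"
        using powi_add[of k "- k"] by simp
      finally show ?thesis
        by (simp add: algebra_simps)
    qed
    then show ?thesis
      using I_uminus I_mult[OF Z_powi pow] by metis
  qed
  then show ?thesis
    using I_mult[OF assms] by (metis mult.commute)
qed

lemma I_dense:
  fixes a b :: real
  assumes "a < b"
  obtains z where "z \<in> I" "a < z" "z < b"
proof -
  have n1: "real (n - 1) > 0"
    using n2 by simp
  obtain k where k: "real n powi k < (b - a) / real (n - 1)"
    using powi_small[of "(b - a) / real (n - 1)"] assms n1 by auto
  define s where "s = real (n - 1) * real n powi k"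
  have s: "s > 0" "s < b - a"
    using k n1 by (simp_all add: s_def field_simps)
  define z where "z = s * of_int (\<lfloor>a / s\<rfloor> + 1)"
  have "z \<in> I"
    unfolding z_def s_def mult.assoc by (intro I_multI Z_mult Z_powi Z_of_int)
  moreover have "a < z"
    using s(1) floor_correct[of "a / s"] by (simp add: z_def field_simps)
  moreover have "z \<le> a + s"
  proof -
    have "s * of_int \<lfloor>a / s\<rfloor> \<le> a"
      using s(1) of_int_floor_le[of "a / s"] by (metis mult.commute pos_le_divide_eq)
    then show ?thesis
      by (simp add: z_def distrib_left)
  qed
  ultimately show thesis
    using that s by force
qed

lemma Z_dense:
  fixes a b :: real
  assumes "a < b"
  obtains z where "z \<in> Z" "a < z" "z < b"
  using I_dense[OF assms] I_subset_Z by metis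

lemma phi_eq_iff:
  assumes "x \<in> Z" "y \<in> Z"
  shows "phi n x = phi n y \<longleftrightarrow> x - y \<in> I"
proof -
  obtain a b e where xy: "x = of_int a * real n powi e" "y = of_int b * real n powi e"
    using Z_common_exponent[OF assms] .
  have n1: "real_of_int (int (n - 1)) = real (n - 1)"
    by simp
  have "phi n x = phi n y \<longleftrightarrow> (a - b) mod int (n - 1) = 0"
    using n2 by (simp add: xy phi_eq mod_eq_dvd_iff dvd_eq_mod_eq_0)
  also have "\<dots> \<longleftrightarrow> x - y \<in> I"
  proof
    assume "(a - b) mod int (n - 1) = 0"
    then obtain c where c: "a - b = int (n - 1) * c"
      by blast
    have "x - y = of_int (a - b) * real n powi e"
      by (simp add: xy algebra_simps)
    also have "\<dots> = real (n - 1) * (of_int c * real n powi e)"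
      by (simp only: c of_int_mult n1 mult.assoc)
    finally show "x - y \<in> I"
      using Z_invI I_multI by metis
  next
    assume "x - y \<in> I"
    then obtain c d where "x - y = real (n - 1) * (of_int c * real n powi d)"
      by (auto simp: Z_ideal_def Z_inv_def)
    then have "x - y = of_int (int (n - 1) * c) * real n powi d"
      by (simp only: of_int_mult n1 mult.assoc)
    moreover have "x - y = of_int (a - b) * real n powi e"
      by (simp add: xy algebra_simps)
    ultimately show "(a - b) mod int (n - 1) = 0"
      using phi_eq[of n "a - b" e] phi_eq[of n "int (n - 1) * c" d] n2 by simp
  qed
  finally show ?thesis .
qed

lemma phi_add:
  assumes "x \<in> Z" "y \<in> Z"
  shows "phi n (x + y) = (phi n x + phi n y) mod int (n - 1)"
proof -
  obtain a b e where xy: "x = of_int a * real n powi e" "y = of_int b * real n powi e"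
    using Z_common_exponent[OF assms] .
  have "x + y = of_int (a + b) * real n powi e"
    by (simp add: xy algebra_simps)
  then have "phi n (x + y) = (a + b) mod int (n - 1)"
    using phi_eq[of n "a + b" e] n2 by simp
  moreover have "phi n x = a mod int (n - 1)" "phi n y = b mod int (n - 1)"
    using phi_eq[of n a e] phi_eq[of n b e] n2 by (simp_all add: xy)
  ultimately show ?thesis
    by (simp add: mod_add_eq)
qed

lemma phi_diff:
  assumes "x \<in> Z" "y \<in> Z"
  shows "(phi n x - phi n y) mod int (n - 1) = phi n (x - y)"
proof -
  have "phi n x = (phi n (x - y) + phi n y) mod int (n - 1)"
    using phi_add[OF Z_diff[OF assms] assms(2)] by simp
  then have "(phi n x - phi n y) mod int (n - 1) = phi n (x - y) mod int (n - 1)"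
    by (simp add: mod_diff_left_eq)
  moreover have "phi n (x - y) = (phi n (x - y) + phi n 0) mod int (n - 1)"
    using phi_add[OF Z_diff[OF assms] Z_numeral(1)] by simp
  ultimately show ?thesis
    by (metis mod_mod_trivial)
qed

section \<open>One-sided germs of elements of A\<close>

lemma powi_inject: "real n powi k = real n powi l \<Longrightarrow> k = l"
  using power_int_strict_increasing[of k l "real n"] power_int_strict_increasing[of l k "real n"] n2
  by (cases k l rule: linorder_cases) auto

definition affine_germ :: "(real \<Rightarrow> real) \<Rightarrow> real \<Rightarrow> real filter \<Rightarrow> int \<Rightarrow> bool" where
  "affine_germ h x F k \<longleftrightarrow> (\<forall>\<^sub>F y in F. h y = h x + real n powi k * (y - x))"

lemma affine_germ_right_quotient:
  assumes "affine_germ h x (at_right x) k"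
  shows "((\<lambda>y. (h y - h x) / (y - x)) \<longlongrightarrow> real n powi k) (at_right x)"
proof (rule tendsto_eventually)
  show "\<forall>\<^sub>F y in at_right x. (h y - h x) / (y - x) = real n powi k"
    using assms eventually_at_right_less[of x] unfolding affine_germ_def by eventually_elim auto
qed

lemma affine_germ_left_quotient:
  assumes "affine_germ h x (at_left x) k"
  shows "((\<lambda>y. (h y - h x) / (y - x)) \<longlongrightarrow> real n powi k) (at_left x)"
proof (rule tendsto_eventually)
  have "\<forall>\<^sub>F y in at_left x. y < x"
    by (auto simp: eventually_at_left_field intro: exI[of _ "x - 1"])
  then show "\<forall>\<^sub>F y in at_left x. (h y - h x) / (y - x) = real n powi k"
    using assms unfolding affine_germ_def by eventually_elim auto
qed

lemma eventually_at_right_interval: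
  fixes x :: real
  assumes "\<forall>\<^sub>F y in at_right x. P y"
  obtains e where "e > 0" "\<And>y. x < y \<Longrightarrow> y < x + e \<Longrightarrow> P y"
proof -
  obtain b where "b > x" "\<forall>y>x. y < b \<longrightarrow> P y"
    using assms by (auto simp: eventually_at_right_field)
  then show thesis
    using that[of "b - x"] by auto
qed

lemma eventually_at_left_interval:
  fixes x :: real
  assumes "\<forall>\<^sub>F y in at_left x. P y"
  obtains e where "e > 0" "\<And>y. x - e < y \<Longrightarrow> y < x \<Longrightarrow> P y"
proof -
  obtain b where "b < x" "\<forall>y>b. y < x \<longrightarrow> P y"
    using assms by (auto simp: eventually_at_left_field)
  then show thesis
    using that[of "x - b"] by auto
qed

lemma affine_germ_nhds:
  assumes "affine_germ h x (at_right x) k" "affine_germ h x (at_left x) k"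
  shows "\<forall>\<^sub>F y in nhds x. h y = h x + real n powi k * (y - x)"
  using assms by (simp add: affine_germ_def eventually_nhds_conv_at eventually_at_split)

lemma affine_near_deriv:
  fixes h :: "real \<Rightarrow> real"
  assumes "\<forall>\<^sub>F y in nhds x. h y = a + m * (y - x)"
  shows "\<forall>\<^sub>F y in nhds x. (h has_real_derivative m) (at y)"
proof -
  obtain T where T: "open T" "x \<in> T" "\<And>y. y \<in> T \<Longrightarrow> h y = a + m * (y - x)"
    using assms by (auto simp: eventually_nhds)
  have "(h has_real_derivative m) (at y)" if "y \<in> T" for y
  proof -
    have "((\<lambda>y. a + m * (y - x)) has_real_derivative m) (at y)"
      by (auto intro!: derivative_eq_intros)
    then show ?thesis
      by (rule has_field_derivative_transform_within_open[OF _ T(1) that]) (simp add: T(3))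
  qed
  then show ?thesis
    using T by (auto simp: eventually_nhds)
qed

text \<open>The closed discrete exceptional set leaves a gap on each side of \<open>x\<close>, and continuity carries the affine formula from
  the gap to \<open>x\<close> itself. Outside \<open>Z[1/n]\<close> there is no break, so \<open>h\<close> is differentiable at \<open>x\<close> and both slopes equal its
  derivative.\<close>

lemma A_carrier_affine_germs:
  assumes "h \<in> A_carrier n"
  shows "\<exists>k l. affine_germ h x (at_right x) k \<and> affine_germ h x (at_left x) l \<and> (x \<notin> Z \<longrightarrow> k = l)"
proof -
  from assms have sl: "\<And>x D. (h has_real_derivative D) (at x) \<Longrightarrow> D \<in> slope_group n"
    and br: "breaks h \<subseteq> Z" and cont: "continuous_on UNIV h"
    and "\<exists>S. closed S \<and> discrete S \<and>
        (\<forall>u v. {u<..<v} \<inter> S = {} \<longrightarrow> (\<exists>m c. \<forall>x\<in>{u<..<v}. h x = m * x + c))"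
    by (auto simp: A_carrier_def piecewise_linear_def)
  then obtain S where S: "closed S" "discrete S"
    "\<And>u v. {u<..<v} \<inter> S = {} \<Longrightarrow> \<exists>m c. \<forall>x\<in>{u<..<v}. h x = m * x + c"
    by blast
  have "\<forall>\<^sub>F y in at x. y \<notin> S"
  proof (cases "x \<in> S")
    case True
    then show ?thesis
      using S(2) by (simp add: discrete_altdef)
  next
    case False
    then have "\<forall>\<^sub>F y in nhds x. y \<in> - S"
      using S(1) by (intro eventually_nhds_in_open) auto
    then show ?thesis
      by (auto simp: eventually_at_filter elim: eventually_mono)
  qed
  then have ev: "\<forall>\<^sub>F y in at_right x. y \<notin> S" "\<forall>\<^sub>F y in at_left x. y \<notin> S"
    by (auto simp: eventually_at_split)
  have piece: "\<exists>k. \<forall>y\<in>{u<..<v}. h y = h x + real n powi k * (y - x)"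
    if uv: "{u<..<v} \<inter> S = {}" "u < v" "x \<in> {u..v}" for u v
  proof -
    obtain m c where mc: "\<forall>y\<in>{u<..<v}. h y = m * y + c"
      using S(3)[OF uv(1)] by blast
    have "closed {y. h y = m * y + c}"
      using cont by (intro closed_Collect_eq continuous_intros)
    then have "closure {u<..<v} \<subseteq> {y. h y = m * y + c}"
      using mc by (intro closure_minimal) auto
    then have hx: "h x = m * x + c"
      using that by auto
    define z where "z = (u + v) / 2"
    have z: "z \<in> {u<..<v}"
      using that(2) by (auto simp: z_def)
    have "\<forall>\<^sub>F y in nhds z. y \<in> {u<..<v}"
      using z by (intro eventually_nhds_in_open) auto
    then have "\<forall>\<^sub>F y in nhds z. h y = (m * z + c) + m * (y - z)"
      using mc by (auto elim!: eventually_mono simp: algebra_simps)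
    then have "(h has_real_derivative m) (at z)"
      using affine_near_deriv eventually_nhds_x_imp_x by blast
    then obtain k where "m = real n powi k"
      using sl by (auto simp: slope_group_def)
    then show ?thesis
      using mc hx by (auto simp: algebra_simps intro!: exI[of _ k])
  qed
  obtain e where e: "e > 0" "\<And>y. x < y \<Longrightarrow> y < x + e \<Longrightarrow> y \<notin> S"
    using ev(1) by (rule eventually_at_right_interval) blast
  obtain k where k: "\<And>y. x < y \<Longrightarrow> y < x + e \<Longrightarrow> h y = h x + real n powi k * (y - x)"
    using piece[of x "x + e"] e by fastforce
  have kr: "affine_germ h x (at_right x) k"
    unfolding affine_germ_def eventually_at_right_field using k e by (intro exI[of _ "x + e"]) auto
  obtain d where d: "d > 0" "\<And>y. x - d < y \<Longrightarrow> y < x \<Longrightarrow> y \<notin> S"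
    using ev(2) by (rule eventually_at_left_interval) blast
  obtain l where l: "\<And>y. x - d < y \<Longrightarrow> y < x \<Longrightarrow> h y = h x + real n powi l * (y - x)"
    using piece[of "x - d" x] d by fastforce
  have lr: "affine_germ h x (at_left x) l"
    unfolding affine_germ_def eventually_at_left_field using l d by (intro exI[of _ "x - d"]) auto
  have "k = l" if "x \<notin> Z"
  proof -
    have "x \<notin> breaks h"
      using br that by blast
    then have "\<forall>\<^sub>F y in nhds x. h differentiable (at y)"
      by (auto simp: breaks_def)
    then have "h differentiable (at x)"
      using eventually_nhds_x_imp_x by blast
    then obtain D where D: "(h has_real_derivative D) (at x)"
      using real_differentiable_def by blast
    then have lim: "((\<lambda>y. (h y - h x) / (y - x)) \<longlongrightarrow> D) (at x)"
      by (simp add: has_field_derivative_iff)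
    have "((\<lambda>y. (h y - h x) / (y - x)) \<longlongrightarrow> real n powi k) (at_right x)"
      using kr by (rule affine_germ_right_quotient)
    moreover have "((\<lambda>y. (h y - h x) / (y - x)) \<longlongrightarrow> real n powi l) (at_left x)"
      using lr by (rule affine_germ_left_quotient)
    ultimately have "real n powi k = D" "real n powi l = D"
      using lim by (auto simp: filterlim_at_split dest: tendsto_unique[rotated 2])
    then show ?thesis
      by (intro powi_inject) simp
  qed
  then show ?thesis
    using kr lr by blast
qed

text \<open>The points where the two one-sided slopes differ serve as the exceptional set: the map is affine on a punctured
  neighbourhood of each point on either side, so these points cannot accumulate. Between them the pair of slope and
  intercept is locally constant, hence constant.\<close>

lemma A_carrierI:
  assumes mono: "strict_mono h" and surj: "surj h"
    and mem: "\<And>x. h x \<in> Z \<longleftrightarrow> x \<in> Z"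
    and germs: "\<And>x. \<exists>k l. affine_germ h x (at_right x) k \<and> affine_germ h x (at_left x) l \<and> (x \<notin> Z \<longrightarrow> k = l)"
  shows "h \<in> A_carrier n"
proof -
  define S where "S = {x. \<not> (\<exists>k. affine_germ h x (at_right x) k \<and> affine_germ h x (at_left x) k)}"
  have cont: "continuous_on UNIV h"
    using strict_mono_surj_continuous[OF mono surj] .
  have near: "\<exists>k. \<forall>\<^sub>F y in nhds x. h y = h x + real n powi k * (y - x)" if "x \<notin> S" for x
    using that affine_germ_nhds unfolding S_def by blast
  have deriv: "\<exists>k. \<forall>\<^sub>F y in nhds x. (h has_real_derivative real n powi k) (at y)" if "x \<notin> S" for x
    using near[OF that] affine_near_deriv by blast
  have off: "y \<notin> S" if uv: "u < v" "u < y" "y < v" and affine: "\<And>z. u < z \<Longrightarrow> z < v \<Longrightarrow> h z = c + real n powi k * (z - x)"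
    for u v x y k c
  proof -
    have "\<forall>\<^sub>F z in nhds y. z \<in> {u<..<v}"
      using that by (intro eventually_nhds_in_open) auto
    moreover have "h z = h y + real n powi k * (z - y)" if z: "z \<in> {u<..<v}" for z
      using affine[of z] affine[of y] uv z by (simp add: algebra_simps)
    ultimately have "\<forall>\<^sub>F z in nhds y. h z = h y + real n powi k * (z - y)"
      by (rule eventually_mono)
    then show ?thesis
      unfolding S_def affine_germ_def by (auto simp: eventually_nhds_conv_at eventually_at_split)
  qed
  have ev: "\<forall>\<^sub>F y in at x. y \<notin> S" for x
  proof -
    obtain k l where kl: "affine_germ h x (at_right x) k" "affine_germ h x (at_left x) l"
      using germs by blast
    obtain e where e: "e > 0" "\<And>y. x < y \<Longrightarrow> y < x + e \<Longrightarrow> h y = h x + real n powi k * (y - x)"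
      using kl(1) unfolding affine_germ_def by (rule eventually_at_right_interval) blast
    have "\<forall>\<^sub>F y in at_right x. y \<notin> S"
      unfolding eventually_at_right_field using e off[of x "x + e"] by (intro exI[of _ "x + e"]) auto
    moreover obtain d where d: "d > 0" "\<And>y. x - d < y \<Longrightarrow> y < x \<Longrightarrow> h y = h x + real n powi l * (y - x)"
      using kl(2) unfolding affine_germ_def by (rule eventually_at_left_interval) blast
    have "\<forall>\<^sub>F y in at_left x. y \<notin> S"
      unfolding eventually_at_left_field using d off[of "x - d" x] by (intro exI[of _ "x - d"]) auto
    ultimately show ?thesis
      by (simp add: eventually_at_split)
  qed
  have "\<not> x islimpt S" for x
    using ev[of x] by (simp add: islimpt_iff_eventually)
  then have closed: "closed S"
    by (simp add: closed_limpt)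
  have discrete: "discrete S"
    using ev by (simp add: discrete_altdef)
  have pl: "\<exists>m c. \<forall>x\<in>{u<..<v}. h x = m * x + c" if S0: "{u<..<v} \<inter> S = {}" for u v
  proof (cases "u < v")
    case True
    define f where "f x = (deriv h x, h x - deriv h x * x)" for x
    have loc: "\<forall>\<^sub>F y in nhds x. f x = f y" if x: "x \<in> {u<..<v}" for x
    proof -
      obtain k where k: "\<forall>\<^sub>F y in nhds x. h y = h x + real n powi k * (y - x)"
        using near[of x] S0 x by blast
      have D: "\<forall>\<^sub>F y in nhds x. deriv h y = real n powi k"
        using affine_near_deriv[OF k] by (rule eventually_mono) (rule DERIV_imp_deriv)
      then have Dx: "deriv h x = real n powi k"
        using eventually_nhds_x_imp_x by blast
      show ?thesis
        using k D by eventually_elim (simp add: f_def Dx algebra_simps)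
    qed
    have "\<forall>\<^sub>F y in at x within {u<..<v}. f x = f y" if "x \<in> {u<..<v}" for x
      using loc[OF that] by (auto simp: eventually_at_filter elim: eventually_mono)
    then have const: "f x = f y" if "x \<in> {u<..<v}" "y \<in> {u<..<v}" for x y
      using that by (intro connected_local_const[of "{u<..<v}"]) auto
    have "h x = fst (f ((u + v) / 2)) * x + snd (f ((u + v) / 2))" if x: "x \<in> {u<..<v}" for x
    proof -
      have "h x = fst (f x) * x + snd (f x)"
        by (simp add: f_def)
      also have "f x = f ((u + v) / 2)"
        by (rule const) (use True x in auto)
      finally show ?thesis .
    qed
    then show ?thesis
      by blast
  qed auto
  have sl: "D \<in> slope_group n" if "(h has_real_derivative D) (at x)" for x D
  proof -
    obtain k where k: "affine_germ h x (at_right x) k"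
      using germs by blast
    have "((\<lambda>y. (h y - h x) / (y - x)) \<longlongrightarrow> real n powi k) (at_right x)"
      using k by (rule affine_germ_right_quotient)
    moreover have "((\<lambda>y. (h y - h x) / (y - x)) \<longlongrightarrow> D) (at_right x)"
      using that by (simp add: has_field_derivative_iff filterlim_at_split)
    ultimately have "D = real n powi k"
      using tendsto_unique trivial_limit_at_right_real by blast
    then show ?thesis
      by (auto simp: slope_group_def)
  qed
  have "breaks h \<subseteq> S"
  proof
    fix x assume x: "x \<in> breaks h"
    show "x \<in> S"
    proof (rule ccontr)
      assume "x \<notin> S"
      then obtain k where k: "\<forall>\<^sub>F y in nhds x. (h has_real_derivative real n powi k) (at y)"
        using deriv by blast
      then have "\<forall>\<^sub>F y in nhds x. h differentiable (at y)"
        by (auto elim!: eventually_mono simp: real_differentiable_def)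
      moreover have "\<forall>\<^sub>F y in nhds x. deriv h y = real n powi k"
        using k by (auto elim!: eventually_mono intro: DERIV_imp_deriv)
      then have "isCont (deriv h) x"
        using isCont_cong[of "deriv h" "\<lambda>_. real n powi k" x] by simp
      ultimately show False
        using x by (simp add: breaks_def)
    qed
  qed
  moreover have "S \<subseteq> Z"
    using germs unfolding S_def by blast
  moreover have "h ` Z = Z"
    using mem surj by (auto simp: image_iff) (metis surjD)
  moreover have "homeomorphism UNIV UNIV h (inv_into UNIV h)"
    using strict_mono_surj_continuous[OF mono surj] strict_mono_inv[OF mono surj] mono surj
    by (simp add: homeomorphism_def strict_mono_surj_continuous surj_f_inv_f strict_mono_imp_inj_on)
  ultimately show ?thesis
    unfolding A_carrier_def piecewise_linear_def
    using mono cont closed discrete pl sl by blast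
qed

lemma A_carrierD:
  assumes "h \<in> A_carrier n"
  shows "strict_mono h" "surj h" "h x \<in> Z \<longleftrightarrow> x \<in> Z"
proof -
  show m: "strict_mono h" and "surj h"
    using assms by (auto simp: A_carrier_def homeomorphism_def)
  have "h ` Z = Z"
    using assms by (auto simp: A_carrier_def)
  then show "h x \<in> Z \<longleftrightarrow> x \<in> Z"
    using strict_mono_imp_inj_on[OF m] by (metis inj_image_mem_iff)
qed

section \<open>The groups A and B\<close>

lemma A_bij: "h \<in> A \<Longrightarrow> bij h"
  using A_carrierD by (simp add: bij_def strict_mono_imp_inj_on)

lemma affine_germ_cong:
  assumes "affine_germ e x F k" "e x = h x" "\<forall>\<^sub>F y in F. h y = e y"
  shows "affine_germ h x F k"
  using assms(1,3) unfolding affine_germ_def by eventually_elim (simp add: assms(2))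

text \<open>Every element of \<open>A\<close> that is constructed by gluing is recognised with this criterion.\<close>

lemma A_locally:
  assumes "strict_mono h" "surj h"
    and loc: "\<And>x. \<exists>e\<in>A. \<exists>e'\<in>A. e x = h x \<and> e' x = h x \<and>
      (\<forall>\<^sub>F y in at_right x. h y = e y) \<and> (\<forall>\<^sub>F y in at_left x. h y = e' y) \<and> (x \<notin> Z \<longrightarrow> e = e')"
  shows "h \<in> A"
proof (rule A_carrierI[OF assms(1,2)])
  fix x
  obtain e e' where e: "e \<in> A" "e' \<in> A" "e x = h x" "e' x = h x"
    "\<forall>\<^sub>F y in at_right x. h y = e y" "\<forall>\<^sub>F y in at_left x. h y = e' y" "x \<notin> Z \<longrightarrow> e = e'"
    using loc[of x] by blast
  show "h x \<in> Z \<longleftrightarrow> x \<in> Z"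
    using A_carrierD(3)[OF e(1), of x] e(3) by simp
  obtain k l where k: "affine_germ e x (at_right x) k" "affine_germ e x (at_left x) l" "x \<notin> Z \<longrightarrow> k = l"
    using A_carrier_affine_germs[OF e(1)] by blast
  obtain k' l' where k': "affine_germ e' x (at_left x) l'"
    using A_carrier_affine_germs[OF e(2)] by blast
  show "\<exists>k l. affine_germ h x (at_right x) k \<and> affine_germ h x (at_left x) l \<and> (x \<notin> Z \<longrightarrow> k = l)"
  proof (cases "x \<in> Z")
    case True
    then show ?thesis
      using affine_germ_cong[OF k(1) e(3,5)] affine_germ_cong[OF k' e(4,6)] by blast
  next
    case False
    then have "affine_germ h x (at_left x) l"
      using k(2) e(3,6,7) by (auto intro!: affine_germ_cong[of e])
    then show ?thesis
      using affine_germ_cong[OF k(1) e(3,5)] k(3) by blast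
  qed
qed

lemma affine_in_A:
  assumes "c \<in> Z"
  shows "(\<lambda>x. real n powi k * x + c) \<in> A"
proof (rule A_carrierI)
  show "strict_mono (\<lambda>x. real n powi k * x + c)"
    by (simp add: strict_mono_def powi_pos)
  show "surj (\<lambda>x. real n powi k * x + c)"
    by (rule surjI[of _ "\<lambda>y. (y - c) / real n powi k"]) (use n2 in simp)
  show "real n powi k * x + c \<in> Z \<longleftrightarrow> x \<in> Z" for x
    using assms by (simp add: Z_add_iff Z_powi_mult_iff)
  show "\<exists>l m. affine_germ (\<lambda>x. real n powi k * x + c) x (at_right x) l \<and>
      affine_germ (\<lambda>x. real n powi k * x + c) x (at_left x) m \<and> (x \<notin> Z \<longrightarrow> l = m)" for x
    unfolding affine_germ_def by (intro exI[of _ k]) (simp add: algebra_simps)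
qed

lemma id_in_A: "id \<in> A"
  using affine_in_A[of 0 0] Z_numeral by (simp add: id_def)

lemma comp_in_A:
  assumes f: "f \<in> A" and g: "g \<in> A"
  shows "g \<circ> f \<in> A"
proof (rule A_carrierI)
  note Df = A_carrierD[OF f] and Dg = A_carrierD[OF g]
  show "strict_mono (g \<circ> f)" "(g \<circ> f) x \<in> Z \<longleftrightarrow> x \<in> Z" for x
    using Df Dg by (auto simp: strict_mono_def)
  show "surj (g \<circ> f)"
    using Df(2) Dg(2) by (rule comp_surj)
  show "\<exists>k l. affine_germ (g \<circ> f) x (at_right x) k \<and> affine_germ (g \<circ> f) x (at_left x) l
      \<and> (x \<notin> Z \<longrightarrow> k = l)" for x
  proof -
    obtain k l where f: "affine_germ f x (at_right x) k" "affine_germ f x (at_left x) l" "x \<notin> Z \<longrightarrow> k = l"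
      using A_carrier_affine_germs[OF f] by blast
    obtain k' l' where g: "affine_germ g (f x) (at_right (f x)) k'" "affine_germ g (f x) (at_left (f x)) l'"
        "f x \<notin> Z \<longrightarrow> k' = l'"
      using A_carrier_affine_germs[OF g] by blast
    have comp: "affine_germ (g \<circ> f) x F (k' + k)"
      if "affine_germ f x F k" "affine_germ g (f x) G k'" "filterlim f G F" for F G k k'
    proof -
      have "\<forall>\<^sub>F y in F. g (f y) = g (f x) + real n powi k' * (f y - f x)"
        using that(2,3) by (auto simp: affine_germ_def filterlim_iff)
      then show ?thesis
        using that(1) unfolding affine_germ_def
        by eventually_elim (simp add: powi_add)
    qed
    have "affine_germ (g \<circ> f) x (at_right x) (k' + k)"
      using comp f(1) g(1) strict_mono_surj_at_right[OF Df(1,2)] by blast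
    moreover have "affine_germ (g \<circ> f) x (at_left x) (l' + l)"
      using comp f(2) g(2) strict_mono_surj_at_left[OF Df(1,2)] by blast
    ultimately show ?thesis
      using f(3) g(3) Df(3)[of x] by blast
  qed
qed

lemma inv_in_A:
  assumes f: "f \<in> A"
  shows "inv_into UNIV f \<in> A"
proof (rule A_carrierI)
  note Df = A_carrierD[OF f]
  let ?g = "inv_into UNIV f"
  have fg [simp]: "f (?g x) = x" for x
    using Df(2) by (simp add: surj_f_inv_f)
  show g: "strict_mono ?g" "surj ?g"
    using strict_mono_inv[OF Df(1,2)] .
  show "?g x \<in> Z \<longleftrightarrow> x \<in> Z" for x
    using Df(3)[of "?g x"] by simp
  show "\<exists>k l. affine_germ ?g x (at_right x) k \<and> affine_germ ?g x (at_left x) l \<and> (x \<notin> Z \<longrightarrow> k = l)" for x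
  proof -
    obtain k l where kl: "affine_germ f (?g x) (at_right (?g x)) k" "affine_germ f (?g x) (at_left (?g x)) l"
        "?g x \<notin> Z \<longrightarrow> k = l"
      using A_carrier_affine_germs[OF f] by blast
    have *: "affine_germ ?g x F (- k)" if "affine_germ f (?g x) G k" "filterlim ?g G F" for F G k
    proof -
      have "\<forall>\<^sub>F y in F. f (?g y) = f (?g x) + real n powi k * (?g y - ?g x)"
        using that by (auto simp: affine_germ_def filterlim_iff)
      then show ?thesis
        unfolding affine_germ_def
      proof eventually_elim
        case (elim y)
        then have "y - x = real n powi k * (?g y - ?g x)"
          by simp
        then have "real n powi (- k) * (y - x) = ?g y - ?g x"
          by (simp only: powi_minus_cancel)
        then show ?case
          by simp
      qed
    qed
    have "affine_germ ?g x (at_right x) (- k)" "affine_germ ?g x (at_left x) (- l)"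
      using * kl strict_mono_surj_at_right[OF g] strict_mono_surj_at_left[OF g] by blast+
    then show ?thesis
      using kl(3) Df(3)[of "?g x"] by auto
  qed
qed

lemma A_group_simps [simp]:
  "carrier (A_group n) = A" "f \<otimes>\<^bsub>A_group n\<^esub> g = g \<circ> f" "\<one>\<^bsub>A_group n\<^esub> = id"
  by (simp_all add: A_group_def)

lemma inv_comp_A: "f \<in> A \<Longrightarrow> f \<circ> inv_into UNIV f = id" "f \<in> A \<Longrightarrow> inv_into UNIV f \<circ> f = id"
  by (simp_all add: A_bij bij_is_surj bij_is_inj surj_iff[symmetric] inj_iff[symmetric])

lemma group_A: "group (A_group n)"
proof (rule groupI)
  fix f assume "f \<in> carrier (A_group n)"
  then show "\<exists>g\<in>carrier (A_group n). g \<otimes>\<^bsub>A_group n\<^esub> f = \<one>\<^bsub>A_group n\<^esub>"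
    using inv_in_A[of f] inv_comp_A[of f] by auto
qed (auto simp: id_in_A comp_in_A comp_assoc)

lemma inv_A_group: "f \<in> A \<Longrightarrow> inv\<^bsub>A_group n\<^esub> f = inv_into UNIV f"
  by (rule group.inv_equality[OF group_A]) (simp_all add: inv_in_A inv_comp_A)

text \<open>The displacement \<open>f x - x\<close> of \<open>f\<close> at an \<open>n\<close>-adic \<open>x\<close> changes by a multiple of \<open>n - 1\<close> when
  \<open>x\<close> moves within one affine piece, because \<open>n\<^sup>k \<equiv> 1\<close>; connectedness of the line does the rest.\<close>

lemma displacement_cong:
  assumes f: "f \<in> A" and xy: "x \<in> Z" "y \<in> Z"
  shows "(f x - x) - (f y - y) \<in> I"
proof -
  note Df = A_carrierD[OF f]
  show ?thesis
  proof (rule connected_induction[where S = UNIV and P = "\<lambda>z. z \<in> Z" and a = y and b = x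
        and Q = "\<lambda>z. (f z - z) - (f y - y) \<in> I"])
    show "connected (UNIV :: real set)"
      by (rule connected_UNIV)
  next
    fix T and a :: real
    assume "openin (top_of_set UNIV) T" "a \<in> T"
    then obtain e where e: "e > 0" "ball a e \<subseteq> T"
      by (auto simp: open_contains_ball)
    obtain z where "z \<in> Z" "a < z" "z < a + e"
      using Z_dense[of a "a + e"] e by auto
    then show "\<exists>z. z \<in> T \<and> z \<in> Z"
      using e by (intro exI[of _ z]) (auto simp: dist_real_def)
  next
    fix a :: real
    obtain k l where kl: "affine_germ f a (at_right a) k" "affine_germ f a (at_left a) l" "a \<notin> Z \<longrightarrow> k = l"
      using A_carrier_affine_germs[OF f] by blast
    obtain e where e: "e > 0" "\<And>y. a < y \<Longrightarrow> y < a + e \<Longrightarrow> f y = f a + real n powi k * (y - a)"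
      using kl(1) unfolding affine_germ_def by (rule eventually_at_right_interval) blast
    obtain d where d: "d > 0" "\<And>y. a - d < y \<Longrightarrow> y < a \<Longrightarrow> f y = f a + real n powi l * (y - a)"
      using kl(2) unfolding affine_germ_def by (rule eventually_at_left_interval) blast
    define T where "T = {a - d <..< a + e}"
    have step: "(f z - z) - (f y - y) \<in> I"
      if "f z - f y = real n powi m * (z - y)" "z \<in> Z" "y \<in> Z" for z y m
    proof -
      have "(f z - z) - (f y - y) = (real n powi m - 1) * (z - y)"
        using that(1) by (simp add: algebra_simps)
      then show ?thesis
        using powi_minus_1_mult_I[OF Z_diff[OF that(2,3)]] by simp
    qed
    have main: "(f z - z) - (f y - y) \<in> I" if yz: "y \<in> T" "z \<in> T" "y \<in> Z" "z \<in> Z" for y z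
    proof (cases "a \<in> Z")
      case True
      have from_a: "(f z - z) - (f a - a) \<in> I" if "z \<in> T" "z \<in> Z" for z
      proof -
        have "\<exists>m. f z - f a = real n powi m * (z - a)"
          using that(1) e(2)[of z] d(2)[of z] by (cases z a rule: linorder_cases) (auto simp: T_def)
        then show ?thesis
          using step[OF _ that(2) True] by blast
      qed
      have "((f z - z) - (f a - a)) - ((f y - y) - (f a - a)) \<in> I"
        by (rule I_diff[OF from_a from_a]) (use yz in auto)
      then show ?thesis
        by (simp add: algebra_simps)
    next
      case False
      have from_a: "f z = f a + real n powi k * (z - a)" if "z \<in> T" for z
        using that e(2)[of z] d(2)[of z] kl(3) False
        by (cases z a rule: linorder_cases) (auto simp: T_def)
      have "f z - f y = real n powi k * (z - y)"
        using from_a[OF yz(1)] from_a[OF yz(2)] by (simp add: algebra_simps)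
      then show ?thesis
        using step yz by blast
    qed
    have "\<forall>z\<in>T. \<forall>w\<in>T. z \<in> Z \<and> w \<in> Z \<and> (f z - z) - (f y - y) \<in> I \<longrightarrow> (f w - w) - (f y - y) \<in> I"
    proof (intro ballI impI)
      fix z w assume zw: "z \<in> T" "w \<in> T" "z \<in> Z \<and> w \<in> Z \<and> (f z - z) - (f y - y) \<in> I"
      then have "((f w - w) - (f z - z)) + ((f z - z) - (f y - y)) \<in> I"
        using main by (intro I_add) auto
      then show "(f w - w) - (f y - y) \<in> I"
        by (simp add: algebra_simps)
    qed
    moreover have "openin (top_of_set UNIV) T" "a \<in> T"
      using e d by (auto simp: T_def)
    ultimately show "\<exists>T. openin (top_of_set UNIV) T \<and> a \<in> T \<and>
        (\<forall>z\<in>T. \<forall>w\<in>T. z \<in> Z \<and> w \<in> Z \<and> (f z - z) - (f y - y) \<in> I \<longrightarrow> (f w - w) - (f y - y) \<in> I)"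
      by blast
  qed (use xy I_0 in auto)
qed

lemma rho_eq:
  assumes f: "f \<in> A" and x: "x \<in> Z"
  shows "rho n f = phi n (f x - x)"
proof -
  have fZ: "f y \<in> Z" if "y \<in> Z" for y
    using A_carrierD(3)[OF f] that by simp
  have "(phi n (f y) - phi n y) mod int (n - 1) = phi n (f x - x)" if "y \<in> Z" for y
    using phi_diff[OF fZ[OF that] that] displacement_cong[OF f that x]
      phi_eq_iff[OF Z_diff[OF fZ[OF that] that] Z_diff[OF fZ[OF x] x]] by simp
  then show ?thesis
    unfolding rho_def using x by (intro the_equality) auto
qed

lemma phi_0_iff: "x \<in> Z \<Longrightarrow> phi n x = 0 \<longleftrightarrow> x \<in> I"
  using phi_eq_iff[of x 0] phi_eq[of n 0 0] n2 Z_numeral(1) by simp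

lemma phi_range: "x \<in> Z \<Longrightarrow> phi n x \<in> {0..<int (n - 1)}"
proof -
  assume "x \<in> Z"
  then obtain a b where "x = of_int a * real n powi b"
    by (auto simp: Z_inv_def)
  then show ?thesis
    using phi_eq[of n a b] n2 by simp
qed

text \<open>Because of \<open>displacement_cong\<close>, a single point decides membership in \<open>B\<close>.\<close>

lemma B_iff:
  assumes "x \<in> Z"
  shows "f \<in> B \<longleftrightarrow> f \<in> A \<and> f x - x \<in> I"
  using rho_eq[OF _ assms, of f] phi_0_iff[OF Z_diff[OF _ assms], of "f x"]
    A_carrierD(3)[of f x] assms
  by (auto simp: B_carrier_def kernel_def)

lemma B_subset_A: "f \<in> B \<Longrightarrow> f \<in> A"
  by (simp add: B_carrier_def kernel_def)

lemma rho_hom: "rho n \<in> hom (A_group n) (integer_mod_group (n - 1))"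
proof (rule homI)
  fix f assume "f \<in> carrier (A_group n)"
  then have f: "f \<in> A" by simp
  have "f 0 - 0 \<in> Z"
    using A_carrierD(3)[OF f, of 0] Z_numeral(1) by simp
  then show "rho n f \<in> carrier (integer_mod_group (n - 1))"
    using rho_eq[OF f, of 0] phi_range[of "f 0 - 0"] n2 Z_numeral(1)
    by (simp add: carrier_integer_mod_group)
next
  fix f g assume "f \<in> carrier (A_group n)" "g \<in> carrier (A_group n)"
  then have f: "f \<in> A" and g: "g \<in> A" by simp_all
  have f0: "f 0 \<in> Z" and gf0: "g (f 0) \<in> Z"
    using A_carrierD(3) f g Z_numeral(1) by simp_all
  have "rho n (g \<circ> f) = phi n ((f 0 - 0) + (g (f 0) - f 0))"
    using rho_eq[OF comp_in_A[OF f g] Z_numeral(1)] by simp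
  also have "\<dots> = (rho n f + rho n g) mod int (n - 1)"
    using rho_eq[OF f Z_numeral(1)] rho_eq[OF g f0]
      phi_add[OF _ Z_diff[OF gf0 f0], of "f 0 - 0"] f0 by simp
  finally show "rho n (f \<otimes>\<^bsub>A_group n\<^esub> g) = rho n f \<otimes>\<^bsub>integer_mod_group (n - 1)\<^esub> rho n g"
    by simp
qed

lemma group_hom_rho: "group_hom (A_group n) (integer_mod_group (n - 1)) (rho n)"
  using group_A rho_hom by (simp add: group_hom_def group_hom_axioms_def)

lemma normal_B: "B \<lhd> A_group n"
  unfolding B_carrier_def by (rule group_hom.normal_kernel[OF group_hom_rho])

lemma subgroup_B: "subgroup B (A_group n)"
  using normal_B by (rule normal_imp_subgroup)

lemma finite_index_B: "finite (rcosets\<^bsub>A_group n\<^esub> B)"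
proof -
  interpret group_hom "A_group n" "integer_mod_group (n - 1)" "rho n"
    by (rule group_hom_rho)
  have "(\<lambda>X. the_elem (rho n ` X)) ` (rcosets\<^bsub>A_group n\<^esub> B) \<subseteq> {0..<int (n - 1)}"
    using FactGroup_the_elem_mem n2
    by (auto simp: B_carrier_def FactGroup_def carrier_integer_mod_group)
  moreover have "inj_on (\<lambda>X. the_elem (rho n ` X)) (rcosets\<^bsub>A_group n\<^esub> B)"
    using FactGroup_inj_on by (simp add: B_carrier_def FactGroup_def)
  ultimately show ?thesis
    using finite_imageD finite_subset by blast
qed

section \<open>Elements of B are commutators\<close>

lemma glue_at:
  assumes f: "f \<in> A" and g: "g \<in> A" and c: "c \<in> Z" and eq: "f c = g c"
  shows "(\<lambda>x. if x \<le> c then f x else g x) \<in> A"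
proof (rule A_locally)
  note Df = A_carrierD[OF f] and Dg = A_carrierD[OF g]
  let ?h = "\<lambda>x. if x \<le> c then f x else g x"
  show "strict_mono ?h"
  proof (rule strict_monoI)
    fix x y :: real assume "x < y"
    moreover have "f x \<le> g c" if "x \<le> c"
      using that strict_mono_less_eq[OF Df(1), of x c] eq by simp
    moreover have "g c < g y" if "c < y"
      using that strict_mono_less[OF Dg(1)] by simp
    ultimately show "?h x < ?h y"
      using strict_mono_less[OF Df(1), of x y] strict_mono_less[OF Dg(1), of x y] by auto
  qed
  show "surj ?h"
  proof (rule surjI)
    fix y
    have "inv_into UNIV f y \<le> c" if "y \<le> f c"
      using that strict_mono_less_eq[OF Df(1), of "inv_into UNIV f y" c] Df(2) by (simp add: surj_f_inv_f)
    moreover have "c < inv_into UNIV g y" if "f c < y"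
      using that strict_mono_less[OF Dg(1), of c "inv_into UNIV g y"] Dg(2) eq by (simp add: surj_f_inv_f)
    ultimately show "?h (if y \<le> f c then inv_into UNIV f y else inv_into UNIV g y) = y"
      using Df(2) Dg(2) by (auto simp: surj_f_inv_f not_le)
  qed
  show "\<exists>e\<in>A. \<exists>e'\<in>A. e x = ?h x \<and> e' x = ?h x \<and> (\<forall>\<^sub>F y in at_right x. ?h y = e y) \<and>
      (\<forall>\<^sub>F y in at_left x. ?h y = e' y) \<and> (x \<notin> Z \<longrightarrow> e = e')" for x
  proof (cases x c rule: linorder_cases)
    case less
    have "\<forall>\<^sub>F y in nhds x. y \<in> {..<c}"
      using less by (intro eventually_nhds_in_open) auto
    then have "\<forall>\<^sub>F y in at x. ?h y = f y"
      by (auto simp: eventually_at_filter elim!: eventually_mono)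
    then show ?thesis
      using less f by (intro bexI[of _ f]) (auto simp: eventually_at_split)
  next
    case greater
    have "\<forall>\<^sub>F y in nhds x. y \<in> {c<..}"
      using greater by (intro eventually_nhds_in_open) auto
    then have "\<forall>\<^sub>F y in at x. ?h y = g y"
      by (auto simp: eventually_at_filter elim!: eventually_mono)
    then show ?thesis
      using greater g by (intro bexI[of _ g]) (auto simp: eventually_at_split)
  next
    case equal
    then show ?thesis
      using f g c eq
      by (intro bexI[of _ g] bexI[of _ f])
        (auto simp: eventually_at_right_field eventually_at_left_field intro: exI[of _ "c + 1"] exI[of _ "c - 1"])
  qed
qed

text \<open>The map constructed here has a break at possibly every grid point. The two unboundedness assumptions make it
  surjective.\<close>

lemma glue_grid:
  fixes e :: "int \<Rightarrow> real \<Rightarrow> real" and w :: real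
  assumes w: "w > 0" "w \<in> Z" and e: "\<And>i. e i \<in> A"
    and match: "\<And>i. e i (w * of_int (i + 1)) = e (i + 1) (w * of_int (i + 1))"
    and below: "\<And>y. \<exists>i. e i (w * of_int i) \<le> y" and above: "\<And>y. \<exists>i. y < e i (w * of_int i)"
  shows "(\<lambda>x. e \<lfloor>x / w\<rfloor> x) \<in> A"
proof (rule A_locally)
  define Y where "Y i = e i (w * of_int i)" for i
  let ?h = "\<lambda>x. e \<lfloor>x / w\<rfloor> x"
  note less = strict_mono_less[OF A_carrierD(1)[OF e]]
  note less_eq = strict_mono_less_eq[OF A_carrierD(1)[OF e]]
  have floor: "\<lfloor>x / w\<rfloor> = i \<longleftrightarrow> w * of_int i \<le> x \<and> x < w * of_int (i + 1)" for x i
    using w(1) by (simp add: floor_eq_iff field_simps)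
  have Y_Suc: "Y (i + 1) = e i (w * of_int (i + 1))" for i
    by (simp only: Y_def match)
  have Y_less: "Y i < Y (i + 1)" for i
    unfolding Y_Suc unfolding Y_def using less w(1) by simp
  have Y_mono: "Y i \<le> Y j" if "i \<le> j" for i j
    using that
  proof (induction j rule: int_ge_induct)
    case (step j)
    then show ?case
      using Y_less[of j] by linarith
  qed simp
  have h_ge: "Y i \<le> ?h x" and h_less: "?h x < Y (i + 1)" if "\<lfloor>x / w\<rfloor> = i" for x i
    using that floor[of x i] less less_eq unfolding Y_Suc by (auto simp: Y_def)
  show "strict_mono ?h"
  proof (rule strict_monoI)
    fix x y :: real assume xy: "x < y"
    then have "\<lfloor>x / w\<rfloor> \<le> \<lfloor>y / w\<rfloor>"
      using w(1) by (intro floor_mono divide_right_mono) auto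
    then consider "\<lfloor>x / w\<rfloor> = \<lfloor>y / w\<rfloor>" | "\<lfloor>x / w\<rfloor> + 1 \<le> \<lfloor>y / w\<rfloor>"
      by linarith
    then show "?h x < ?h y"
    proof cases
      case 1
      then show ?thesis
        using less xy by simp
    next
      case 2
      then show ?thesis
        using h_less[OF refl, of x] Y_mono[OF 2] h_ge[OF refl, of y] by linarith
    qed
  qed
  show "surj ?h"
    unfolding surj_def
  proof
    fix y
    obtain i j where ij: "Y i \<le> y" "y < Y j"
      using below[of y] above[of y] by (auto simp: Y_def)
    define K where "K = {i..j} \<inter> {k. Y k \<le> y}"
    have "i \<le> j"
      using Y_mono[of j i] ij by linarith
    then have "i \<in> K"
      using ij by (simp add: K_def)
    then have K: "finite K" "K \<noteq> {}"
      by (auto simp: K_def)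
    define k where "k = Max K"
    have "k \<in> K"
      using Max_in[OF K] by (simp add: k_def)
    then have k: "Y k \<le> y" "i \<le> k" "k \<le> j"
      by (auto simp: K_def)
    have "k \<noteq> j"
      using k ij by auto
    moreover have "k + 1 \<notin> K"
      using Max_ge[OF K(1), of "k + 1"] by (auto simp: k_def)
    ultimately have "y < Y (k + 1)"
      using k by (auto simp: K_def)
    obtain x where x: "y = e k x"
      using A_carrierD(2)[OF e] by (rule surjE)
    have "w * of_int k \<le> x"
      using k(1) less_eq unfolding x Y_def by simp
    moreover have "x < w * of_int (k + 1)"
      using \<open>y < Y (k + 1)\<close> less unfolding x Y_Suc by simp
    ultimately have "\<lfloor>x / w\<rfloor> = k"
      using floor by blast
    then show "\<exists>x. y = ?h x"
      using x by auto
  qed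
  show "\<exists>f\<in>A. \<exists>f'\<in>A. f x = ?h x \<and> f' x = ?h x \<and> (\<forall>\<^sub>F y in at_right x. ?h y = f y) \<and>
      (\<forall>\<^sub>F y in at_left x. ?h y = f' y) \<and> (x \<notin> Z \<longrightarrow> f = f')" for x
  proof -
    define i where "i = \<lfloor>x / w\<rfloor>"
    have x: "w * of_int i \<le> x" "x < w * of_int (i + 1)"
      using floor[of x i] by (auto simp: i_def)
    have piece: "?h y = e i y" if "w * of_int i \<le> y" "y < w * of_int (i + 1)" for y
      using that floor[THEN iffD2, of i y] by simp
    have right: "\<forall>\<^sub>F y in at_right x. ?h y = e i y"
      unfolding eventually_at_right_field
    proof (intro exI[of _ "w * of_int (i + 1)"] conjI allI impI)
      show "?h y = e i y" if "x < y" "y < w * of_int (i + 1)" for y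
        using piece[of y] x(1) that by linarith
    qed (rule x(2))
    show ?thesis
    proof (cases "x = w * of_int i")
      case True
      have "\<lfloor>y / w\<rfloor> = i - 1" if "x - w < y" "y < x" for y
        using that floor[THEN iffD2, of "i - 1" y] by (simp add: True right_diff_distrib)
      then have "\<forall>\<^sub>F y in at_left x. ?h y = e (i - 1) y"
        unfolding eventually_at_left_field using w(1) by (intro exI[of _ "x - w"]) auto
      moreover have "e (i - 1) x = e i x"
        using match[of "i - 1"] by (simp add: True)
      moreover have "x \<in> Z"
        unfolding True using w(2) by (intro Z_mult Z_of_int)
      ultimately show ?thesis
        using right e by (intro bexI[of _ "e i"] bexI[of _ "e (i - 1)"]) (auto simp: i_def)
    next
      case False
      then have lt: "w * of_int i < x"
        using x(1) by simp
      have "\<forall>\<^sub>F y in at_left x. ?h y = e i y"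
        unfolding eventually_at_left_field
      proof (intro exI[of _ "w * of_int i"] conjI allI impI)
        show "?h y = e i y" if "w * of_int i < y" "y < x" for y
          using piece[of y] x(2) that by linarith
      qed (rule lt)
      then show ?thesis
        using right e by (intro bexI[of _ "e i"]) (auto simp: i_def)
    qed
  qed
qed

text \<open>Slope \<open>n\<close> on a unit interval lengthens it by \<open>n - 1\<close>; repetition and rescaling stretch \<open>[0, n - 1]\<close> to any
  length in the ideal.\<close>

lemma stretch_exists:
  assumes "d \<in> I" "d > 0"
  shows "\<exists>e\<in>A. e 0 = 0 \<and> e (real n - 1) = d"
proof -
  have nat_case: "\<exists>e\<in>A. e 0 = 0 \<and> e (real n - 1) = (real n - 1) * real (Suc a)" for a
  proof (induction a)
    case 0
    then show ?case
      using id_in_A by (intro bexI[of _ id]) auto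
  next
    case (Suc a)
    then obtain e where e: "e \<in> A" "e 0 = 0" "e (real n - 1) = (real n - 1) * real (Suc a)"
      by blast
    \<comment> \<open>Lengthen the last unit interval of the image by the factor \<open>n\<close>.\<close>
    define c where "c = (real n - 1) * real (Suc a) - 1"
    have "c = of_int ((int n - 1) * int (Suc a) - 1)"
      by (simp add: c_def)
    then have c: "c \<in> Z"
      using Z_of_int by metis
    have "(real n - 1) * real (Suc a) \<ge> 1 * 1"
      using n2 by (intro mult_mono) auto
    then have c0: "c \<ge> 0"
      by (simp add: c_def)
    define s where "s x = (if x \<le> c then id x else real n powi 1 * x + (c - real n * c))" for x
    have "s \<in> A"
      unfolding s_def using c
      by (intro glue_at id_in_A affine_in_A Z_diff) (auto simp: Z_mult_n)
    then have "s \<circ> e \<in> A"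
      using e(1) comp_in_A by blast
    moreover have "(s \<circ> e) 0 = 0"
      using c0 by (simp add: e(2) s_def)
    moreover have "(s \<circ> e) (real n - 1) = (real n - 1) * real (Suc (Suc a))"
    proof -
      have "e (real n - 1) = c + 1"
        by (simp add: e(3) c_def)
      then have "(s \<circ> e) (real n - 1) = real n * (c + 1) + (c - real n * c)"
        by (simp add: s_def)
      also have "\<dots> = c + 1 + (real n - 1)"
        by (simp add: algebra_simps)
      also have "\<dots> = (real n - 1) * real (Suc (Suc a))"
        by (simp add: c_def algebra_simps)
      finally show ?thesis .
    qed
    ultimately show ?case
      by blast
  qed
  obtain a b where ab: "d = real (n - 1) * (of_int a * real n powi b)"
    using assms(1) by (auto simp: Z_ideal_def Z_inv_def)
  have "a > 0"
    using assms(2) n2 powi_pos[of b] by (simp add: ab zero_less_mult_iff)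
  then obtain a' where a': "a = int (Suc a')"
    using zero_less_imp_eq_int[of a] by (metis Suc_pred)
  obtain e where e: "e \<in> A" "e 0 = 0" "e (real n - 1) = (real n - 1) * real (Suc a')"
    using nat_case by blast
  have "(\<lambda>x. real n powi b * x + 0) \<circ> e \<in> A"
    using comp_in_A[OF e(1) affine_in_A[OF Z_numeral(1)]] .
  then show ?thesis
    using e n2 by (intro bexI[of _ "(\<lambda>x. real n powi b * x + 0) \<circ> e"])
      (auto simp: ab a' of_nat_diff)
qed

lemma stretch_between:
  assumes "s \<in> Z" "x \<in> Z" "x < y" "y - x \<in> I"
  shows "\<exists>e\<in>A. e s = x \<and> e (s + (real n - 1)) = y"
proof -
  obtain e where e: "e \<in> A" "e 0 = 0" "e (real n - 1) = y - x"
    using stretch_exists[of "y - x"] assms by auto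
  have s: "(\<lambda>t. real n powi 0 * t + (- s)) \<in> A"
    using assms(1) by (intro affine_in_A Z_uminus)
  have x: "(\<lambda>t. real n powi 0 * t + x) \<in> A"
    using assms(2) by (rule affine_in_A)
  have "(\<lambda>t. real n powi 0 * t + x) \<circ> (e \<circ> (\<lambda>t. real n powi 0 * t + (- s))) \<in> A"
    using comp_in_A[OF comp_in_A[OF s e(1)] x] .
  then show ?thesis
    using e by (intro bexI[of _ "(\<lambda>t. real n powi 0 * t + x) \<circ> (e \<circ> (\<lambda>t. real n powi 0 * t + (- s)))"]) auto
qed

text \<open>\<open>[0, n - 1]\<close> and \<open>[0, p 0]\<close> are fundamental intervals for the translation and for \<open>p\<close>. A map from \<open>A\<close> that
  takes the one to the other extends equivariantly to the line; the translates \<open>p\<^sup>i 0\<close> exhaust the line because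
  their supremum or infimum would be fixed by \<open>p\<close>.\<close>

lemma conj_to_translation:
  assumes p: "p \<in> A" and p0: "p 0 \<in> I" and pos: "\<And>x. x < p x"
  shows "\<exists>u\<in>A. \<forall>x. u (x + (real n - 1)) = p (u x)"
proof -
  interpret group "A_group n"
    by (rule group_A)
  note simps = A_group_simps
  define w where "w = real n - 1"
  have w: "w > 0" "w \<in> Z"
    using n2 by (auto simp: w_def intro: Z_diff simp: Z_of_nat Z_numeral)
  define P where "P i = p [^]\<^bsub>A_group n\<^esub> (i :: int)" for i
  have P: "P i \<in> A" for i
    using int_pow_closed[of p i] p by (simp add: P_def simps)
  have P0: "P 0 = id"
    by (simp add: P_def simps)
  have P1: "P 1 = p"
    using p by (simp add: P_def simps int_pow_1)
  have P_add: "P (i + j) = P j \<circ> P i" for i j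
    using int_pow_mult[of p i j] p by (simp add: P_def simps)
  have P_Suc: "P (i + 1) x = p (P i x)" for i x
    using P_add[of i 1] by (simp add: P1)
  have P_Suc': "P (i + 1) x = P i (p x)" for i x
    using P_add[of 1 i] by (simp add: P1 add.commute)
  obtain e where e: "e \<in> A" "e 0 = 0" "e w = p 0"
    using stretch_exists[OF p0] pos[of 0] by (auto simp: w_def)
  define E where "E i = P i \<circ> (e \<circ> (\<lambda>t. real n powi 0 * t + - (w * of_int i)))" for i :: int
  have E_eq: "E i x = P i (e (x - w * of_int i))" for i x
    by (simp add: E_def)
  have E_A: "E i \<in> A" for i
    unfolding E_def using w(2)
    by (intro comp_in_A P e(1) affine_in_A Z_uminus Z_mult Z_of_int)
  have E_grid: "E i (w * of_int i) = P i 0" for i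
    by (simp add: E_eq e(2))
  have P_less: "P i x < P i y \<longleftrightarrow> x < y" for i x y
    using strict_mono_less[OF A_carrierD(1)[OF P]] .
  have above: "\<exists>i. y < P i 0" for y
  proof (rule ccontr)
    assume "\<nexists>i. y < P i 0"
    then have bdd: "bdd_above (range (\<lambda>i. P i 0))"
      by (auto simp: bdd_above_def not_less)
    define s where "s = (SUP i. P i 0)"
    obtain r where r: "s = p r"
      using A_carrierD(2)[OF p] by (rule surjE)
    have "r < s"
      using pos[of r] r by simp
    then obtain i where "r < P i 0"
      using less_cSUP_iff[OF _ bdd] by (auto simp: s_def)
    then have "s < P (i + 1) 0"
      using strict_mono_less[OF A_carrierD(1)[OF p]] by (simp add: r P_Suc)
    moreover have "P (i + 1) 0 \<le> s"
      unfolding s_def using bdd by (intro cSUP_upper) auto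
    ultimately show False by simp
  qed
  have below: "\<exists>i. P i 0 \<le> y" for y
  proof (rule ccontr)
    assume "\<nexists>i. P i 0 \<le> y"
    then have bdd: "bdd_below (range (\<lambda>i. P i 0))"
      by (auto simp: bdd_below_def not_le intro!: exI[of _ y] less_imp_le)
    define s where "s = (INF i. P i 0)"
    obtain i where "P i 0 < p s"
      using pos[of s] cINF_less_iff[OF _ bdd] by (auto simp: s_def)
    then have "p (P (i - 1) 0) < p s"
      using P_Suc[of "i - 1" 0] by simp
    then have "P (i - 1) 0 < s"
      using strict_mono_less[OF A_carrierD(1)[OF p]] by simp
    moreover have "s \<le> P (i - 1) 0"
      unfolding s_def using bdd by (intro cINF_lower) auto
    ultimately show False by simp
  qed
  have match: "E i (w * of_int (i + 1)) = E (i + 1) (w * of_int (i + 1))" for i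
  proof -
    have "E i (w * of_int (i + 1)) = P i (e w)"
      by (simp add: E_eq algebra_simps)
    also have "\<dots> = P (i + 1) 0"
      by (simp add: e(3) P_Suc')
    finally show ?thesis
      by (simp only: E_grid)
  qed
  define u where "u x = E \<lfloor>x / w\<rfloor> x" for x
  have "u \<in> A"
    unfolding u_def by (rule glue_grid[OF w E_A match]) (unfold E_grid, rule below, rule above)
  moreover have "u (x + w) = p (u x)" for x
  proof -
    have "\<lfloor>(x + w) / w\<rfloor> = \<lfloor>x / w\<rfloor> + 1"
      using w(1) by (simp add: add_divide_distrib)
    then show ?thesis
      using P_Suc[of "\<lfloor>x / w\<rfloor>"] by (simp add: u_def E_eq algebra_simps)
  qed
  ultimately show ?thesis
    by (auto simp: w_def)
qed

text \<open>Interpolate a step function: the grid points are sent to points of the ideal chosen so low that even the value at the right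
  end of a grid interval stays below both \<open>y\<close> and \<open>f y\<close> at its left end.\<close>

lemma dominated_element:
  assumes f: "f \<in> A"
  shows "\<exists>q\<in>A. q 0 \<in> I \<and> (\<forall>y. q y < y \<and> q y < f y)"
proof -
  define w where "w = real n - 1"
  have w: "w > 0" "w \<in> Z"
    using n2 by (auto simp: w_def intro: Z_diff simp: Z_of_nat Z_numeral)
  define m where "m y = min (f y) y" for y
  have m_less: "m x < m y" if "x < y" for x y
    using that strict_mono_less[OF A_carrierD(1)[OF f], of x y] by (auto simp: m_def)
  have "\<forall>i::int. \<exists>x. x \<in> I \<and> m (w * of_int (i - 2)) < x \<and> x < m (w * of_int (i - 1))"
  proof
    fix i :: int
    have "m (w * of_int (i - 2)) < m (w * of_int (i - 1))"
      using w(1) by (intro m_less) simp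
    then show "\<exists>x. x \<in> I \<and> m (w * of_int (i - 2)) < x \<and> x < m (w * of_int (i - 1))"
      using I_dense by metis
  qed
  then obtain X where X: "\<And>i::int. X i \<in> I" "\<And>i. m (w * of_int (i - 2)) < X i"
    "\<And>i. X i < m (w * of_int (i - 1))"
    by metis
  have "\<exists>e\<in>A. e (w * of_int i) = X i \<and> e (w * of_int (i + 1)) = X (i + 1)" for i
  proof -
    have "X i < X (i + 1)"
      using X(3)[of i] X(2)[of "i + 1"] by simp
    then have "\<exists>e\<in>A. e (w * of_int i) = X i \<and> e (w * of_int i + (real n - 1)) = X (i + 1)"
      using X(1) w(2)
      by (intro stretch_between[of "w * of_int i" "X i" "X (i + 1)"])
        (auto intro: I_diff I_subset_Z Z_mult simp: Z_of_int)
    then show ?thesis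
      by (simp add: w_def algebra_simps)
  qed
  then obtain e where e: "\<And>i. e i \<in> A" "\<And>i. e i (w * of_int i) = X i"
    "\<And>i. e i (w * of_int (i + 1)) = X (i + 1)"
    by metis
  define q where "q x = e \<lfloor>x / w\<rfloor> x" for x
  have "q \<in> A"
    unfolding q_def
  proof (rule glue_grid[OF w e(1)])
    show "e i (w * of_int (i + 1)) = e (i + 1) (w * of_int (i + 1))" for i
      by (simp only: e)
    show "\<exists>i. e i (w * of_int i) \<le> y" for y
    proof -
      obtain i :: int where "of_int i < y / w"
        using ex_of_int_less by blast
      then have "w * of_int i < y"
        using w(1) by (simp add: field_simps)
      moreover have "X (i + 1) < w * of_int i"
        using X(3)[of "i + 1"] by (simp add: m_def)
      ultimately show ?thesis
        unfolding e by (intro exI[of _ "i + 1"]) simp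
    qed
    show "\<exists>i. y < e i (w * of_int i)" for y
    proof -
      obtain z where z: "y = f z"
        using A_carrierD(2)[OF f] by (rule surjE)
      obtain i :: int where "max y z / w < of_int i"
        using ex_less_of_int by blast
      then have i: "max y z < w * of_int i"
        using w(1) by (simp add: field_simps)
      then have "y < f (w * of_int i)"
        unfolding z using strict_mono_less[OF A_carrierD(1)[OF f]] by simp
      then have "y < m (w * of_int i)"
        using i by (simp add: m_def)
      then show ?thesis
        unfolding e using X(2)[of "i + 2"] by (intro exI[of _ "i + 2"]) simp
    qed
  qed
  moreover have "q y < m y" for y
  proof -
    define i where "i = \<lfloor>y / w\<rfloor>"
    have "of_int i \<le> y / w" "y / w < of_int (i + 1)"
      using floor_correct[of "y / w"] by (simp_all add: i_def)
    then have i: "w * of_int i \<le> y" "y < w * of_int (i + 1)"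
      using w(1) by (simp_all add: pos_le_divide_eq pos_divide_less_eq mult.commute)
    have "q y < e i (w * of_int (i + 1))"
      using i strict_mono_less[OF A_carrierD(1)[OF e(1)]] by (simp add: q_def i_def)
    also have "\<dots> < m (w * of_int i)"
      using X(3)[of "i + 1"] by (simp only: e) simp
    also have "\<dots> \<le> m y"
      using i(1) m_less[of "w * of_int i" y] by (cases "w * of_int i = y") auto
    finally show ?thesis .
  qed
  moreover have "q 0 \<in> I"
    using e(2)[of 0] X(1) by (simp add: q_def)
  ultimately show ?thesis
    by (intro bexI[of _ q]) (auto simp: m_def)
qed

text \<open>With \<open>q\<close> from \<open>dominated_element\<close> and \<open>p = q\<^sup>-\<^sup>1\<close>, both \<open>p\<close> and \<open>p \<circ> f\<close> move every point to the
  right, so both are conjugate to the translation by \<open>n - 1\<close> and hence to one another.\<close>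

lemma B_commutator:
  assumes "f \<in> B"
  shows "\<exists>p\<in>A. \<exists>c\<in>A. p \<circ> f \<circ> c = c \<circ> p"
proof -
  interpret B: subgroup B "A_group n"
    by (rule subgroup_B)
  have f: "f \<in> A"
    using assms B_subset_A by blast
  obtain q where q: "q \<in> A" "q 0 \<in> I" "\<And>y. q y < y" "\<And>y. q y < f y"
    using dominated_element[OF f] by blast
  have qB: "q \<in> B"
    using B_iff[OF Z_numeral(1), of q] q by simp
  define p where "p = inv_into UNIV q"
  have pB: "p \<in> B"
    using B.m_inv_closed[OF qB] inv_A_group[OF q(1)] by (simp add: p_def)
  then have p: "p \<in> A"
    using B_subset_A by blast
  have qp: "q (p x) = x" "p (q x) = x" for x
    using inv_comp_A[OF q(1)] by (simp_all add: p_def fun_eq_iff)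
  have p_pos: "x < p x" for x
    using q(3)[of "p x"] by (simp add: qp)
  have pf_pos: "x < (p \<circ> f) x" for x
    using strict_mono_less[OF A_carrierD(1)[OF p], of "q x" "f x"] q(4)[of x] by (simp add: qp)
  have pfB: "p \<circ> f \<in> B"
    using B.m_closed[OF assms pB] by (simp add: A_group_simps)
  have at_0: "g 0 \<in> I" if "g \<in> B" for g
    using that B_iff[OF Z_numeral(1), of g] by simp
  obtain u where u: "u \<in> A" "\<And>x. u (x + (real n - 1)) = p (u x)"
    using conj_to_translation[OF p at_0[OF pB] p_pos] by blast
  obtain v where v: "v \<in> A" "\<And>x. v (x + (real n - 1)) = (p \<circ> f) (v x)"
    using conj_to_translation[OF B_subset_A[OF pfB] at_0[OF pfB] pf_pos] by blast
  define c where "c = v \<circ> inv_into UNIV u"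
  have "c \<in> A"
    unfolding c_def using u(1) v(1) by (intro comp_in_A inv_in_A)
  moreover have "p \<circ> f \<circ> c = c \<circ> p"
  proof
    fix y
    define x where "x = inv_into UNIV u y"
    have iu: "inv_into UNIV u (u x) = x" "u (inv_into UNIV u x) = x" for x
      using inv_comp_A[OF u(1)] by (simp_all add: fun_eq_iff)
    have y: "y = u x"
      by (simp add: x_def iu)
    have "(c \<circ> p) y = c (u (x + (real n - 1)))"
      by (simp add: y u(2))
    also have "\<dots> = (p \<circ> f \<circ> c) y"
      by (simp add: c_def iu v(2) y)
    finally show "(p \<circ> f \<circ> c) y = (c \<circ> p) y" by simp
  qed
  ultimately show ?thesis
    using p by blast
qed

text \<open>An automorphism carries the commutator relation for \<open>f\<close> into one for its image, and \<open>\<rho>\<close> takes values in an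
  abelian group.\<close>

lemma auto_image_B_subset:
  assumes a: "a \<in> auto (A_group n)"
  shows "a ` B \<subseteq> B"
proof
  fix g assume "g \<in> a ` B"
  then obtain f where f: "f \<in> B" "g = a f"
    by blast
  obtain p c where pc: "p \<in> A" "c \<in> A" "p \<circ> f \<circ> c = c \<circ> p"
    using B_commutator[OF f(1)] by blast
  note simps = A_group_simps
  have fA: "f \<in> A"
    using f B_subset_A by blast
  have hom: "a \<in> hom (A_group n) (A_group n)"
    using a by (simp add: auto_def)
  have closed: "a x \<in> A" if "x \<in> A" for x
    using hom_in_carrier[OF hom] that by (simp add: simps)
  have mult: "a (y \<circ> x) = a y \<circ> a x" if "x \<in> A" "y \<in> A" for x y
    using hom_mult[OF hom] that by (simp add: simps)
  have rho: "rho n (y \<circ> x) = (rho n x + rho n y) mod int (n - 1)" if "x \<in> A" "y \<in> A" for x y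
    using hom_mult[OF rho_hom] that by (simp add: simps)
  have "a p \<circ> a f \<circ> a c = a (p \<circ> f \<circ> c)"
    by (simp only: mult comp_in_A pc(1,2) fA)
  also have "\<dots> = a c \<circ> a p"
    using pc by (simp add: mult)
  finally have "rho n (a p \<circ> a f \<circ> a c) = rho n (a c \<circ> a p)"
    by simp
  then have "(rho n (a c) + (rho n (a f) + rho n (a p))) mod int (n - 1)
      = (rho n (a p) + rho n (a c)) mod int (n - 1)"
    using pc fA closed by (simp add: rho comp_in_A mod_add_right_eq)
  then have "rho n (a f) mod int (n - 1) = 0"
    by (simp add: mod_eq_dvd_iff)
  moreover have "rho n (a f) \<in> {0..<int (n - 1)}"
    using hom_in_carrier[OF rho_hom, of "a f"] closed[OF fA] n2
    by (simp add: simps carrier_integer_mod_group)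
  ultimately have "rho n (a f) = 0"
    by simp
  then show "g \<in> B"
    using closed[OF fA] by (simp add: f(2) B_carrier_def kernel_def simps)
qed

lemma auto_image_B:
  assumes a: "a \<in> auto (A_group n)"
  shows "a ` B = B"
proof
  show "a ` B \<subseteq> B"
    using auto_image_B_subset[OF a] .
  interpret group "A_group n"
    by (rule group_A)
  have aB: "a \<in> Bij A" "a \<in> hom (A_group n) (A_group n)"
    using a by (simp_all add: auto_def A_group_simps)
  let ?b = "restrict (inv_into A a) A"
  have "?b \<in> auto (A_group n)"
    using restrict_inv_into_hom[OF aB(2)] aB(1) restrict_inv_into_Bij[OF aB(1)]
    by (simp add: auto_def A_group_simps)
  then have "?b ` B \<subseteq> B"
    by (rule auto_image_B_subset)
  then show "B \<subseteq> a ` B"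
  proof (intro subsetI)
    fix f assume f: "f \<in> B"
    then have fA: "f \<in> A"
      by (rule B_subset_A)
    have "?b f \<in> B"
      using \<open>?b ` B \<subseteq> B\<close> f by blast
    moreover have "a (?b f) = f"
      using aB(1) fA by (simp add: Bij_def bij_betw_def f_inv_into_f)
    ultimately show "f \<in> a ` B"
      by (metis imageI)
  qed
qed

theorem characteristic_B: "characteristic_subgroup B (A_group n)"
  using subgroup_B auto_image_B by (simp add: characteristic_subgroup_def)

section \<open>Conjugation on B and the restriction homomorphism\<close>

text \<open>A generator of Thompson's group, acting on \<open>[1, 2]\<close>: the tree that divides \<open>[1, 2]\<close> into \<open>n\<close> parts and then the first
  part again is mapped to the tree that divides \<open>[1, 2]\<close> and then the last part. The three pieces are the dilation by \<open>n\<close>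
  at 1, a translation, and the inverse of the dilation by \<open>n\<close> at 2.\<close>

definition bump :: "real \<Rightarrow> real" where
  "bump x =
    (if x \<le> 1 then x
     else if x \<le> 1 + 1 / real n - 1 / (real n * real n) then real n * x + (1 - real n)
     else if x \<le> 1 + 1 / real n then x + (1 - 2 / real n + 1 / (real n * real n))
     else if x \<le> 2 then x / real n + (2 - 2 / real n)
     else x)"

lemma bump_in_A: "bump \<in> A"
proof -
  have inv: "1 / real n \<in> Z" "1 / (real n * real n) \<in> Z" "2 / real n \<in> Z"
    using Z_divide_n[of 1] Z_divide_n[of 2] Z_divide_n[of "1 / real n"]
      Z_numeral by simp_all
  note Zs = Z_add Z_diff inv Z_numeral Z_of_nat
  have maps: "(\<lambda>x. x) \<in> A" "(\<lambda>x. real n * x + (1 - real n)) \<in> A"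
    "(\<lambda>x. x + (1 - 2 / real n + 1 / (real n * real n))) \<in> A" "(\<lambda>x. x / real n + (2 - 2 / real n)) \<in> A"
    using affine_in_A[of 0 0] affine_in_A[of "1 - real n" 1]
      affine_in_A[of "1 - 2 / real n + 1 / (real n * real n)" 0]
      affine_in_A[of "2 - 2 / real n" "-1"]
    by (simp_all add: Zs power_int_minus field_simps)
  show ?thesis
    unfolding bump_def
    by (intro glue_at maps Zs) (use n2 in \<open>simp_all add: field_simps\<close>)
qed

lemma bump_fixed: "x \<notin> {1<..<2} \<Longrightarrow> bump x = x"
proof -
  assume x: "x \<notin> {1<..<2}"
  have "1 / real n < 1" "1 / (real n * real n) > 0"
    using n2 by simp_all
  then have "1 + 1 / real n < 2" "1 + 1 / real n - 1 / (real n * real n) < 2"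
    by linarith+
  then show ?thesis
    using x by (cases "x \<le> 1"; cases "x = 2") (auto simp: bump_def)
qed

lemma bump_greater: "x \<in> {1<..<2} \<Longrightarrow> x < bump x"
proof -
  assume x: "x \<in> {1<..<2}"
  have "0 < (1 - 1 / real n) * (1 - 1 / real n)"
    using n2 by simp
  then have "0 < 1 - 2 / real n + 1 / (real n * real n)"
    by (simp add: algebra_simps)
  moreover have "(real n - 1) * (x - 1) > 0" "(1 - 1 / real n) * (2 - x) > 0"
    using n2 x by simp_all
  ultimately show ?thesis
    using x by (auto simp: bump_def algebra_simps)
qed

text \<open>A rescaled copy of \<open>bump\<close> on a short interval around \<open>y\<close> that avoids \<open>x\<close>.\<close>

lemma separating_element:
  assumes "x \<noteq> y"
  shows "\<exists>b\<in>B. b x = x \<and> b y \<noteq> y"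
proof -
  obtain k where k: "real n powi k < \<bar>x - y\<bar>"
    using powi_small[of "\<bar>x - y\<bar>"] assms by auto
  define s where "s = real n powi k"
  have s: "s > 0" "s \<in> Z"
    by (simp_all add: s_def powi_pos Z_powi)
  obtain z where z: "z \<in> Z" "y - s < z" "z < y"
    using Z_dense[of "y - s" y] s by auto
  define scale unscale where "scale = (\<lambda>t. real n powi k * t + (z - s))"
    and "unscale = (\<lambda>t. real n powi (- k) * t + - (real n powi (- k) * (z - s)))"
  define b where "b = scale \<circ> (bump \<circ> unscale)"
  have unscale: "unscale t = (t - z) / s + 1" for t
  proof -
    have "unscale t = (t - (z - s)) / s"
      by (simp add: unscale_def s_def power_int_minus divide_inverse algebra_simps)
    then show ?thesis
      using s(1) by (simp add: field_simps)
  qed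
  have b: "b t = s * bump ((t - z) / s + 1) + (z - s)" for t
    by (simp add: b_def unscale scale_def s_def)
  have "b \<in> A"
    unfolding b_def scale_def unscale_def using z(1) s(2)
    by (intro comp_in_A bump_in_A affine_in_A)
      (auto simp: Z_powi_mult_iff intro!: Z_diff Z_uminus)
  moreover have "b z - z \<in> I"
    using I_0 by (simp add: b bump_fixed)
  ultimately have "b \<in> B"
    using B_iff[OF z(1)] by simp
  moreover have "b y \<noteq> y"
  proof -
    have "(y - z) / s + 1 \<in> {1<..<2}"
      using s z by (simp add: field_simps)
    then have "s * ((y - z) / s + 1) < s * bump ((y - z) / s + 1)"
      by (intro mult_strict_left_mono bump_greater s(1))
    then show ?thesis
      using s by (simp add: b distrib_left)
  qed
  moreover have "b x = x"
  proof -
    have "(x - z) / s + 1 \<notin> {1<..<2}"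
      using k s z by (auto simp: s_def[symmetric] field_simps)
    then have "b x = s * ((x - z) / s + 1) + (z - s)"
      by (simp only: b bump_fixed[of "(x - z) / s + 1"] not_False_eq_True)
    then show ?thesis
      using s by (simp add: distrib_left)
  qed
  ultimately show ?thesis
    by blast
qed

text \<open>A map that commutes with \<open>b\<close> preserves the fixed points of \<open>b\<close>.\<close>

lemma centralizer_B_trivial:
  assumes "\<And>b. b \<in> B \<Longrightarrow> c \<circ> b = b \<circ> c"
  shows "c = id"
proof
  fix x
  show "c x = id x"
  proof (rule ccontr)
    assume "c x \<noteq> id x"
    then obtain b where b: "b \<in> B" "b x = x" "b (c x) \<noteq> c x"
      using separating_element[of x "c x"] by auto
    then show False
      using fun_cong[OF assms[OF b(1)], of x] by simp
  qed
qed

text \<open>This serves twice: for the injectivity of the restriction, with two elements of \<open>A\<close>, and for the identification of an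
  automorphism of \<open>A\<close> that restricts to conjugation by a homeomorphism outside \<open>A\<close>.\<close>

lemma conjugation_on_B_determines:
  fixes f g :: "real \<Rightarrow> real"
  assumes "bij g" and same: "\<And>b. b \<in> B \<Longrightarrow> \<exists>b'. f \<circ> b = b' \<circ> f \<and> g \<circ> b = b' \<circ> g"
  shows "f = g"
proof -
  let ?g' = "inv_into UNIV g"
  have g: "?g' (g x) = x" "g (?g' x) = x" for x
    using assms(1) by (simp_all add: bij_is_inj bij_is_surj surj_f_inv_f)
  have "?g' \<circ> f = id"
  proof (rule centralizer_B_trivial)
    fix b assume "b \<in> B"
    then obtain b' where b': "f \<circ> b = b' \<circ> f" "g \<circ> b = b' \<circ> g"
      using same by blast
    show "?g' \<circ> f \<circ> b = b \<circ> (?g' \<circ> f)"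
    proof
      fix x
      have "f (b x) = b' (g (?g' (f x)))"
        using fun_cong[OF b'(1), of x] by (simp add: g)
      also have "\<dots> = g (b (?g' (f x)))"
        using fun_cong[OF b'(2)] by (metis comp_apply)
      finally show "(?g' \<circ> f \<circ> b) x = (b \<circ> (?g' \<circ> f)) x"
        by (simp add: g)
    qed
  qed
  then show ?thesis
    by (metis comp_apply eq_id_iff g(2) ext)
qed

lemma group_B: "group (B_group n)"
  unfolding B_group_def by (rule subgroup.subgroup_is_group[OF subgroup_B group_A])

lemma B_group_simps [simp]:
  "carrier (B_group n) = B" "f \<otimes>\<^bsub>B_group n\<^esub> g = g \<circ> f"
  by (simp_all add: B_group_def A_group_def)

lemma comp_in_B: "f \<in> B \<Longrightarrow> g \<in> B \<Longrightarrow> g \<circ> f \<in> B"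
  using subgroup.m_closed[OF subgroup_B, of f g] by (simp add: A_group_simps)

lemma inv_in_B: "f \<in> B \<Longrightarrow> inv_into UNIV f \<in> B"
  using subgroup.m_inv_closed[OF subgroup_B, of f] inv_A_group B_subset_A by simp

lemma conj_in_B:
  assumes "f \<in> A" "b \<in> B"
  shows "f \<circ> b \<circ> inv_into UNIV f \<in> B"
  using normal.inv_op_closed1[OF normal_B, of f b] assms
  by (simp add: A_group_simps inv_A_group comp_assoc)

lemma AutoGroup_carrier: "carrier (AutoGroup G) = auto G"
  by (simp add: AutoGroup_def)

lemma AutoGroup_mult:
  "a \<in> auto G \<Longrightarrow> b \<in> auto G \<Longrightarrow> a \<otimes>\<^bsub>AutoGroup G\<^esub> b = compose (carrier G) a b"
  by (simp add: AutoGroup_def BijGroup_def auto_def)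

lemma autoA_comp:
  "a \<in> auto (A_group n) \<Longrightarrow> f \<in> A \<Longrightarrow> g \<in> A \<Longrightarrow> a (g \<circ> f) = a g \<circ> a f"
  using hom_mult[of a "A_group n" "A_group n" f g] by (simp add: auto_def A_group_simps)

lemma autoA_closed: "a \<in> auto (A_group n) \<Longrightarrow> f \<in> A \<Longrightarrow> a f \<in> A"
  using hom_in_carrier[of a "A_group n" "A_group n" f] by (simp add: auto_def A_group_simps)

lemma restr_aut_in_auto:
  assumes a: "a \<in> auto (A_group n)"
  shows "restr_aut n a \<in> auto (B_group n)"
proof -
  have "inj_on a A"
    using a by (simp add: auto_def Bij_def bij_betw_def A_group_simps)
  then have "bij_betw a B B"
    using auto_image_B[OF a] B_subset_A by (auto simp: bij_betw_def intro: inj_on_subset)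
  moreover from this have "a b \<in> B" if "b \<in> B" for b
    using that by (rule bij_betwE[rule_format])
  moreover have "a (g \<circ> f) = a g \<circ> a f" if "f \<in> B" "g \<in> B" for f g
    using autoA_comp[OF a] that B_subset_A by blast
  ultimately show ?thesis
    by (auto simp: restr_aut_def auto_def Bij_def hom_def comp_in_B)
qed

lemma restr_aut_hom: "restr_aut n \<in> hom (AutoGroup (A_group n)) (AutoGroup (B_group n))"
proof (rule homI)
  show "restr_aut n a \<in> carrier (AutoGroup (B_group n))" if "a \<in> carrier (AutoGroup (A_group n))" for a
    using that restr_aut_in_auto by (simp add: AutoGroup_carrier)
next
  fix a b assume "a \<in> carrier (AutoGroup (A_group n))" "b \<in> carrier (AutoGroup (A_group n))"
  then have ab: "a \<in> auto (A_group n)" "b \<in> auto (A_group n)"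
    by (simp_all add: AutoGroup_carrier)
  have "b f \<in> B" if "f \<in> B" for f
    using auto_image_B[OF ab(2)] that by blast
  then have "restr_aut n (compose A a b) = compose B (restr_aut n a) (restr_aut n b)"
    using B_subset_A by (auto simp: restr_aut_def compose_def restrict_def fun_eq_iff)
  then show "restr_aut n (a \<otimes>\<^bsub>AutoGroup (A_group n)\<^esub> b)
      = restr_aut n a \<otimes>\<^bsub>AutoGroup (B_group n)\<^esub> restr_aut n b"
    by (simp add: AutoGroup_mult ab restr_aut_in_auto A_group_simps)
qed

text \<open>For \<open>f \<in> A\<close> and \<open>b \<in> B\<close> the conjugate of \<open>b\<close> by \<open>f\<close> is in the normal subgroup \<open>B\<close>, so the action of the
  image of \<open>f\<close> on \<open>B\<close> by conjugation is known from the restriction.\<close>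

lemma restr_aut_inj: "inj_on (restr_aut n) (auto (A_group n))"
proof (rule inj_onI)
  fix a a' assume a: "a \<in> auto (A_group n)" and a': "a' \<in> auto (A_group n)"
    and eq: "restr_aut n a = restr_aut n a'"
  have eqB: "a b = a' b" if "b \<in> B" for b
    using fun_cong[OF eq, of b] that by (simp add: restr_aut_def)
  have "a f = a' f" if f: "f \<in> A" for f
  proof (rule conjugation_on_B_determines)
    show "bij (a' f)"
      using A_bij[OF autoA_closed[OF a' f]] .
    fix b assume "b \<in> B"
    then obtain b0 where b0: "b0 \<in> B" "b = a b0"
      using auto_image_B[OF a] by blast
    have b0A: "b0 \<in> A"
      using b0 B_subset_A by blast
    define b1 where "b1 = f \<circ> b0 \<circ> inv_into UNIV f"
    have b1: "b1 \<in> B" "b1 \<in> A"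
      using conj_in_B[OF f b0(1)] B_subset_A by (auto simp: b1_def)
    have "f \<circ> b0 = b1 \<circ> f"
      using inv_comp_A(2)[OF f] by (simp add: b1_def comp_assoc)
    then have "a f \<circ> a b0 = a b1 \<circ> a f" "a' f \<circ> a' b0 = a' b1 \<circ> a' f"
      using autoA_comp[OF a] autoA_comp[OF a'] f b0A b1(2) by metis+
    then show "\<exists>b'. a f \<circ> b = b' \<circ> a f \<and> a' f \<circ> b = b' \<circ> a' f"
      using eqB[OF b0(1)] eqB[OF b1(1)] b0(2) by auto
  qed
  moreover have "a \<in> extensional A" "a' \<in> extensional A"
    using a a' by (simp_all add: auto_def Bij_def A_group_simps)
  ultimately show "a = a'"
    by (metis extensionalityI)
qed

lemma restr_aut_mon: "restr_aut n \<in> mon (AutoGroup (A_group n)) (AutoGroup (B_group n))"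
  using restr_aut_hom restr_aut_inj by (simp add: mon_def AutoGroup_carrier)

lemma restr_aut_image_subgroup:
  "subgroup (restr_aut n ` carrier (AutoGroup (A_group n))) (AutoGroup (B_group n))"
  using restr_aut_hom group.AutoGroup[OF group_A] group.AutoGroup[OF group_B]
  by (intro group_hom.img_is_subgroup) (simp add: group_hom_def group_hom_axioms_def)

section \<open>Homeomorphisms that normalise B\<close>

text \<open>The constant terms lie in the ideal: the germ is defined on an interval, which contains points of \<open>Z[1/n]\<close>, and there
  both the displacement of \<open>f\<close> and the multiples of \<open>n\<^sup>k - 1\<close> are in the ideal.\<close>

lemma B_locally_affine:
  assumes f: "f \<in> B"
  obtains k c l d where "c \<in> I" "d \<in> I" "f x = real n powi k * x + c" "f x = real n powi l * x + d"
    "\<forall>\<^sub>F y in at_right x. f y = real n powi k * y + c"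
    "\<forall>\<^sub>F y in at_left x. f y = real n powi l * y + d" "x \<notin> Z \<longrightarrow> k = l \<and> c = d"
proof -
  have fA: "f \<in> A"
    using f B_subset_A by blast
  obtain k l where kl: "affine_germ f x (at_right x) k" "affine_germ f x (at_left x) l" "x \<notin> Z \<longrightarrow> k = l"
    using A_carrier_affine_germs[OF fA] by blast
  have eq: "f x + real n powi m * (y - x) = real n powi m * y + (f x - real n powi m * x)" for m y
    by (simp add: algebra_simps)
  have in_I: "f x - real n powi m * x \<in> I"
    if "z \<in> Z" "f z = real n powi m * z + (f x - real n powi m * x)" for z m
  proof -
    have "(f z - z) - (real n powi m - 1) * z \<in> I"
      using B_iff[OF that(1)] f powi_minus_1_mult_I[OF that(1)] I_diff by blast
    then show ?thesis
      using that(2) by (simp add: algebra_simps)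
  qed
  obtain e where e: "e > 0"
    "\<And>y. x < y \<Longrightarrow> y < x + e \<Longrightarrow> f y = real n powi k * y + (f x - real n powi k * x)"
    using kl(1) unfolding affine_germ_def eq by (rule eventually_at_right_interval) blast
  obtain z where "z \<in> Z" "x < z" "z < x + e"
    using Z_dense[of x "x + e"] e(1) by auto
  then have c: "f x - real n powi k * x \<in> I"
    using in_I e(2) by blast
  obtain d where d: "d > 0"
    "\<And>y. x - d < y \<Longrightarrow> y < x \<Longrightarrow> f y = real n powi l * y + (f x - real n powi l * x)"
    using kl(2) unfolding affine_germ_def eq by (rule eventually_at_left_interval) blast
  obtain z where "z \<in> Z" "x - d < z" "z < x"
    using Z_dense[of "x - d" x] d(1) by auto
  then have "f x - real n powi l * x \<in> I"
    using in_I d(2) by blast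
  then show thesis
    using that[OF c, of "f x - real n powi l * x" k l] kl unfolding affine_germ_def eq by auto
qed

definition conj_by :: "(real \<Rightarrow> real) \<Rightarrow> (real \<Rightarrow> real) \<Rightarrow> real \<Rightarrow> real" where
  "conj_by k f = k \<circ> f \<circ> inver k"

lemma inver_simps:
  assumes "strict_mono k" "surj k"
  shows "inver k (k x) = x" "k (inver k x) = x"
  using assms by (simp_all add: surj_f_inv_f strict_mono_imp_inj_on)

lemma scaling_translation_in_B:
  "(\<lambda>x. real n powi k * x) \<in> B" "(\<lambda>x. x + (real n - 1) * of_int a) \<in> B"
proof -
  have "(\<lambda>x. real n powi k * x) \<in> A"
    using affine_in_A[OF Z_numeral(1), of k] by simp
  then show "(\<lambda>x. real n powi k * x) \<in> B"
    using B_iff[OF Z_numeral(1)] I_0 by simp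
  have c: "(real n - 1) * of_int a \<in> I"
    using I_multI(1)[OF Z_of_int[of a]] n2 by (simp add: of_nat_diff)
  then have "(\<lambda>x. x + (real n - 1) * of_int a) \<in> A"
    using affine_in_A[OF I_subset_Z[OF c], of 0] by simp
  then show "(\<lambda>x. x + (real n - 1) * of_int a) \<in> B"
    using B_iff[OF Z_numeral(1)] c by simp
qed

text \<open>Each affine piece of an element of \<open>B\<close> is composed of \<open>x \<mapsto> n x\<close>, \<open>x \<mapsto> x + (n - 1)\<close> and their
  inverses, so control over the conjugates of these two maps suffices.\<close>

lemma conj_affine_in_B:
  assumes k: "strict_mono k" "surj k"
    and M: "conj_by k (\<lambda>x. real n * x) \<in> B" and T: "conj_by k (\<lambda>x. x + (real n - 1)) \<in> B"
  shows "conj_by k (\<lambda>x. real n powi e * x) \<in> B"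
    and "c \<in> I \<Longrightarrow> conj_by k (\<lambda>x. real n powi e * x + c) \<in> B"
proof -
  note ik = inver_simps[OF k]
  have comp: "conj_by k (f \<circ> g) = conj_by k f \<circ> conj_by k g" for f g
    by (simp add: conj_by_def fun_eq_iff ik)
  have family: "conj_by k (F i) \<in> B"
    if F: "\<And>i j. F (i + j) = F i \<circ> F j" "F 0 = id" "conj_by k (F 1) \<in> B" for F :: "int \<Rightarrow> real \<Rightarrow> real" and i
  proof -
    have id: "conj_by k (F 0) = id"
      by (simp add: conj_by_def fun_eq_iff ik F(2))
    have "conj_by k (F 1) \<circ> conj_by k (F (-1)) = id" "conj_by k (F (-1)) \<circ> conj_by k (F 1) = id"
      using F(1)[of 1 "-1"] F(1)[of "-1" 1] id by (simp_all add: comp[symmetric])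
    then have "conj_by k (F (-1)) = inver (conj_by k (F 1))"
      by (metis inv_unique_comp)
    then have minus: "conj_by k (F (-1)) \<in> B"
      using inv_in_B[OF F(3)] by simp
    show ?thesis
    proof (induction i rule: int_induct[where k = 0])
      case base
      have "id \<in> B"
        using id_in_A B_iff[OF Z_numeral(1), of id] I_0 by simp
      then show ?case
        by (simp only: id)
    next
      case (step1 i)
      then show ?case
        using comp_in_B[OF step1(2) F(3)] F(1)[of 1 i] by (simp only: comp add.commute)
    next
      case (step2 i)
      then show ?case
        using comp_in_B[OF step2(2) minus] F(1)[of "-1" i] by (simp only: comp uminus_add_conv_diff)
    qed
  qed
  have scale: "conj_by k (\<lambda>x. real n powi e * x) \<in> B" for e
  proof (rule family[of "\<lambda>e x. real n powi e * x"])
    show "(\<lambda>x. real n powi (i + j) * x) = (\<lambda>x. real n powi i * x) \<circ> (\<lambda>x. real n powi j * x)" for i j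
      by (simp only: fun_eq_iff comp_apply powi_add mult.assoc simp_thms)
  qed (use M in \<open>simp_all add: fun_eq_iff\<close>)
  have shift: "conj_by k (\<lambda>x. x + (real n - 1) * of_int a) \<in> B" for a
  proof (rule family[of "\<lambda>a x. x + (real n - 1) * of_int a"])
    show "(\<lambda>x. x + (real n - 1) * of_int (i + j))
        = (\<lambda>x. x + (real n - 1) * of_int i) \<circ> (\<lambda>x. x + (real n - 1) * of_int j)" for i j
      by (simp add: fun_eq_iff distrib_left)
  qed (use T in \<open>simp_all add: fun_eq_iff\<close>)
  show "conj_by k (\<lambda>x. real n powi e * x) \<in> B"
    by (rule scale)
  assume "c \<in> I"
  then obtain a b where c: "c = real (n - 1) * (of_int a * real n powi b)"
    by (auto simp: Z_ideal_def Z_inv_def)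
  have "(\<lambda>x. real n powi e * x + c)
      = (\<lambda>x. real n powi b * x) \<circ> ((\<lambda>x. x + (real n - 1) * of_int a) \<circ> (\<lambda>x. real n powi (e - b) * x))"
  proof
    fix x
    have "real n powi e = real n powi b * real n powi (e - b)"
      by (simp flip: powi_add)
    then show "real n powi e * x + c = ((\<lambda>x. real n powi b * x) \<circ>
        ((\<lambda>x. x + (real n - 1) * of_int a) \<circ> (\<lambda>x. real n powi (e - b) * x))) x"
      using n2 by (simp add: c of_nat_diff algebra_simps)
  qed
  then show "conj_by k (\<lambda>x. real n powi e * x + c) \<in> B"
    using comp_in_B[OF comp_in_B[OF scale shift] scale] by (simp only: comp)
qed

text \<open>Every element of \<open>Z[1/n]\<close> is an integer moved by a power of \<open>x \<mapsto> n x\<close>.\<close>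

lemma conj_preserves_Z:
  assumes k: "strict_mono k" "surj k" "\<And>i. k (of_int i) = of_int i"
    and M: "conj_by k (\<lambda>x. real n * x) \<in> B" and T: "conj_by k (\<lambda>x. x + (real n - 1)) \<in> B"
    and x: "x \<in> Z"
  shows "k x \<in> Z"
proof -
  obtain a b where ab: "x = of_int a * real n powi b"
    using x by (auto simp: Z_inv_def)
  have "k x = conj_by k (\<lambda>x. real n powi b * x) (k (of_int a))"
    by (simp add: conj_by_def inver_simps[OF k(1,2)] ab mult.commute)
  also have "\<dots> \<in> Z"
    using A_carrierD(3)[OF B_subset_A[OF conj_affine_in_B(1)[OF k(1,2) M T]]] k(3) Z_of_int
    by simp
  finally show ?thesis .
qed

text \<open>The assumptions on the inverse of \<open>k\<close> enter only through \<open>Z[1/n]\<close>: they guarantee that \<open>k\<close> maps no point from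
  outside into it, so that points outside \<open>Z[1/n]\<close> again have equal germs on both sides.\<close>

lemma conj_in_B_of_generators:
  assumes k: "strict_mono k" "surj k" "\<And>i. k (of_int i) = of_int i"
    and M: "conj_by k (\<lambda>x. real n * x) \<in> B" and T: "conj_by k (\<lambda>x. x + (real n - 1)) \<in> B"
    and M': "conj_by (inver k) (\<lambda>x. real n * x) \<in> B" and T': "conj_by (inver k) (\<lambda>x. x + (real n - 1)) \<in> B"
    and f: "f \<in> B"
  shows "conj_by k f \<in> B"
proof -
  note ik = inver_simps[OF k(1,2)]
  note k' = strict_mono_inv[OF k(1,2)]
  note Df = A_carrierD[OF B_subset_A[OF f]]
  have k'_int: "inver k (of_int i) = of_int i" for i
    using ik(1)[of "of_int i"] by (simp add: k(3))
  have kZ: "inver k x \<in> Z \<longleftrightarrow> x \<in> Z" for x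
    using conj_preserves_Z[OF k M T, of "inver k x"] conj_preserves_Z[OF k' k'_int M' T', of x]
    by (auto simp: ik)
  have aff: "conj_by k (\<lambda>x. real n powi e * x + c) \<in> B" if "c \<in> I" for e c
    using conj_affine_in_B(2)[OF k(1,2) M T that] .
  have "conj_by k f \<in> A"
  proof (rule A_locally)
    show "strict_mono (conj_by k f)"
      using k(1) k'(1) Df(1) by (auto simp: conj_by_def strict_mono_def)
    show "surj (conj_by k f)"
      unfolding conj_by_def using k(2) k'(2) Df(2) by (intro comp_surj)
    fix x
    obtain e c l d where g: "c \<in> I" "d \<in> I" "f (inver k x) = real n powi e * inver k x + c"
      "f (inver k x) = real n powi l * inver k x + d"
      "\<forall>\<^sub>F y in at_right (inver k x). f y = real n powi e * y + c"
      "\<forall>\<^sub>F y in at_left (inver k x). f y = real n powi l * y + d" "inver k x \<notin> Z \<longrightarrow> e = l \<and> c = d"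
      by (rule B_locally_affine[OF f, of "inver k x"])
    let ?u = "conj_by k (\<lambda>x. real n powi e * x + c)" and ?v = "conj_by k (\<lambda>x. real n powi l * x + d)"
    have "\<forall>\<^sub>F y in at_right x. f (inver k y) = real n powi e * inver k y + c"
      using g(5) strict_mono_surj_at_right[OF k', of x] by (rule eventually_compose_filterlim)
    then have "\<forall>\<^sub>F y in at_right x. conj_by k f y = ?u y"
      by eventually_elim (simp add: conj_by_def)
    moreover have "\<forall>\<^sub>F y in at_left x. f (inver k y) = real n powi l * inver k y + d"
      using g(6) strict_mono_surj_at_left[OF k', of x] by (rule eventually_compose_filterlim)
    then have "\<forall>\<^sub>F y in at_left x. conj_by k f y = ?v y"
      by eventually_elim (simp add: conj_by_def)
    moreover have "?u x = conj_by k f x" "?v x = conj_by k f x"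
      using g(3,4) by (simp_all add: conj_by_def)
    moreover have "x \<notin> Z \<longrightarrow> ?u = ?v"
      using g(7) kZ by auto
    moreover have "?u \<in> A" "?v \<in> A"
      using aff g(1,2) B_subset_A by blast+
    ultimately show "\<exists>e\<in>A. \<exists>e'\<in>A. e x = conj_by k f x \<and> e' x = conj_by k f x \<and>
      (\<forall>\<^sub>F y in at_right x. conj_by k f y = e y) \<and> (\<forall>\<^sub>F y in at_left x. conj_by k f y = e' y) \<and>
      (x \<notin> Z \<longrightarrow> e = e')"
      by blast
  qed
  moreover have "conj_by k f 0 - 0 \<in> I"
  proof -
    obtain e c where c: "c \<in> I" "f 0 = real n powi e * 0 + c"
      by (rule B_locally_affine[OF f, of 0])
    then have "conj_by k f 0 = conj_by k (\<lambda>x. real n powi e * x + c) 0"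
      using k'_int[of 0] by (simp add: conj_by_def)
    then show ?thesis
      using aff[OF c(1), of e] B_iff[OF Z_numeral(1)] by simp
  qed
  ultimately show ?thesis
    using B_iff[OF Z_numeral(1)] by simp
qed

section \<open>The exotic homeomorphism\<close>

lemma n_ge_3: "N \<ge> 3"
  using n2 by simp

text \<open>The interval \<open>[(n - 1) q, (n - 1) q + 1]\<close> is of type 0; multiplied by \<open>n\<close> it starts at \<open>n (n - 1) q\<close>, and the
  second of its \<open>n\<close> parts becomes \<open>[n (n - 1) q + 1, n (n - 1) q + 2]\<close>. The copies of \<open>bump\<close> therefore have this
  period.\<close>

abbreviation period where "period \<equiv> N * (N - 1)"

lemma period_ge: "period \<ge> 2 * N"
  using mult_mono[of N N 2 "N - 1"] n_ge_3 by (simp add: mult.commute)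

lemma bump_mono: "strict_mono (bump)"
  using A_carrierD(1)[OF bump_in_A] .

lemma bump_period: "bump period = period"
proof (rule bump_fixed)
  show "period \<notin> {1<..<2}"
    unfolding greaterThanLessThan_iff using period_ge n_ge_3 by linarith
qed

definition twist :: "real \<Rightarrow> real" where
  "twist x = bump (x - period * of_int \<lfloor>x / period\<rfloor>) + period * of_int \<lfloor>x / period\<rfloor>"

lemma twist_in_A: "twist \<in> A"
proof -
  define e where "e i x = bump (x - period * of_int i) + period * of_int i" for i x
  have period: "period > 0" "period \<in> Z"
    using n_ge_3 Z_mult[of N "N - 1"] Z_diff[of N 1] by (simp_all add: Z_of_nat Z_numeral)
  have "bump 0 = 0"
    by (simp add: bump_fixed)
  note fixed = this bump_period
  have eA: "e i \<in> A" for i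
  proof -
    have c: "period * of_int i \<in> Z"
      using Z_mult[OF period(2)] Z_of_int by blast
    have "(\<lambda>x. N powi 0 * x + period * of_int i) \<circ> (bump \<circ> (\<lambda>x. N powi 0 * x + - (period * of_int i))) \<in> A"
      by (intro comp_in_A affine_in_A bump_in_A Z_uminus c)
    moreover have "(\<lambda>x. N powi 0 * x + period * of_int i) \<circ> (bump \<circ> (\<lambda>x. N powi 0 * x + - (period * of_int i))) = e i"
      by (simp add: e_def fun_eq_iff)
    ultimately show ?thesis by simp
  qed
  have match: "e i (period * of_int (i + 1)) = e (i + 1) (period * of_int (i + 1))" for i
  proof -
    have "period * of_int (i + 1) - period * of_int i = period"
      by (simp add: algebra_simps)
    then have "e i (period * of_int (i + 1)) = period + period * of_int i"
      by (simp only: e_def fixed)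
    moreover have "e (i + 1) (period * of_int (i + 1)) = period * of_int (i + 1)"
      by (simp only: e_def diff_self fixed add_0_left)
    ultimately show ?thesis
      by (simp add: algebra_simps)
  qed
  have eg: "e i (period * of_int i) = period * of_int i" for i
    by (simp add: e_def fixed)
  have below: "\<exists>i. e i (period * of_int i) \<le> y" for y
  proof -
    obtain i :: int where "of_int i < y / period"
      using ex_of_int_less by blast
    then have "period * of_int i < y"
      using period(1) by (simp add: pos_less_divide_eq mult.commute)
    then show ?thesis
      using eg by (intro exI[of _ i]) simp
  qed
  have above: "\<exists>i. y < e i (period * of_int i)" for y
  proof -
    obtain i :: int where "y / period < of_int i"
      using ex_less_of_int by blast
    then have "y < period * of_int i"
      using period(1) by (simp add: pos_divide_less_eq mult.commute)
    then show ?thesis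
      using eg by (intro exI[of _ i]) simp
  qed
  have "twist = (\<lambda>x. e \<lfloor>x / period\<rfloor> x)"
    by (simp add: e_def twist_def fun_eq_iff)
  then show ?thesis
    using glue_grid[OF period eA match below above] by simp
qed

lemma twist_mono: "strict_mono twist"
  using A_carrierD(1)[OF twist_in_A] .

lemma twist_shift: "twist (x + period * of_int j) = twist x + period * of_int j"
proof -
  have "period \<noteq> 0"
    using n_ge_3 by simp
  then have "\<lfloor>(x + period * of_int j) / period\<rfloor> = \<lfloor>x / period\<rfloor> + j"
    by (simp only: add_divide_distrib) simp
  then show ?thesis
    by (simp add: twist_def algebra_simps)
qed

lemma twist_base:
  assumes "0 \<le> x" "x \<le> period"
  shows "twist x = bump x"
proof (cases "x = period")
  case True
  have "twist (0 + period * of_int 1) = twist 0 + period * of_int 1"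
    by (rule twist_shift)
  then show ?thesis
    using True bump_fixed[of 0] bump_period by (simp add: twist_def)
next
  case False
  then have "\<lfloor>x / period\<rfloor> = 0"
    using assms n_ge_3 by (simp add: floor_eq_iff)
  then show ?thesis
    by (simp add: twist_def)
qed

lemma twist_fixed_base: "0 \<le> x \<Longrightarrow> x \<le> period \<Longrightarrow> x \<notin> {1<..<2} \<Longrightarrow> twist x = x"
  by (simp add: twist_base bump_fixed)

text \<open>\<open>[n i, n i + 1]\<close> is the first of the \<open>n\<close> parts of a unit interval multiplied by \<open>n\<close>, and only second parts are
  twisted.\<close>

lemma twist_fixed_first_child:
  assumes "N * of_int i \<le> x" "x \<le> N * of_int i + 1"
  shows "twist x = x"
proof -
  define q r where "q = i div (int n - 1)" and "r = i mod (int n - 1)"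
  have i: "i = q * (int n - 1) + r"
    unfolding q_def r_def by (rule div_mult_mod_eq[symmetric])
  have r: "0 \<le> r" "r < int n - 1"
    using n2 by (simp_all add: r_def)
  have Ni: "N * of_int i = period * of_int q + N * of_int r"
    by (simp add: i algebra_simps)
  define y where "y = x - period * of_int q"
  have y: "N * of_int r \<le> y" "y \<le> N * of_int r + 1"
    using assms by (simp_all add: y_def Ni)
  have "twist y = y"
  proof (rule twist_fixed_base)
    have "0 \<le> N * of_int r"
      using r n_ge_3 by simp
    then show "0 \<le> y"
      using y(1) by linarith
    have "N * of_int r \<le> N * of_int (int n - 2)"
      using r n_ge_3 by (intro mult_left_mono) auto
    also have "\<dots> = period - N"
      by (simp add: algebra_simps)
    finally show "y \<le> period"
      using y(2) n_ge_3 by linarith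
    show "y \<notin> {1<..<2}"
    proof (cases "r = 0")
      case False
      then have "N * 1 \<le> N * of_int r"
        using r n_ge_3 by (intro mult_left_mono) auto
      then show ?thesis
        unfolding greaterThanLessThan_iff using y n_ge_3 by linarith
    qed (use y in auto)
  qed
  then show ?thesis
    using twist_shift[of y q] by (simp add: y_def)
qed

lemma twist_of_int: "twist (of_int i) = of_int i"
proof -
  define q r where "q = i div (int n * (int n - 1))" and "r = i mod (int n * (int n - 1))"
  have pos: "int n * (int n - 1) > 0"
    using n2 by simp
  have i: "i = q * (int n * (int n - 1)) + r"
    unfolding q_def r_def by (rule div_mult_mod_eq[symmetric])
  have r: "0 \<le> r" "r < int n * (int n - 1)"
    using pos by (simp_all add: r_def)
  have "of_int r \<le> (of_int (int n * (int n - 1)) :: real)"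
    using r by (intro of_int_le_iff[THEN iffD2]) simp
  then have "twist (of_int r) = of_int r"
    using r by (intro twist_fixed_base) auto
  then show ?thesis
    using twist_shift[of "of_int r" q] by (simp add: i algebra_simps)
qed

lemma twist_near: "\<bar>twist x - x\<bar> \<le> 1"
proof -
  have "\<bar>bump r - r\<bar> \<le> 1" for r
  proof (cases "r \<in> {1<..<2}")
    case True
    then have "bump 1 < bump r" "bump r < bump 2"
      using strict_mono_less[OF bump_mono] by auto
    then show ?thesis
      using True bump_fixed[of 1] bump_fixed[of 2] by auto
  qed (simp add: bump_fixed)
  moreover have "twist x - x = bump (x - period * of_int \<lfloor>x / period\<rfloor>) - (x - period * of_int \<lfloor>x / period\<rfloor>)"
    by (simp add: twist_def)
  ultimately show ?thesis
    by (simp only:)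
qed

lemma twist_in_B: "twist \<in> B"
  using B_iff[OF Z_numeral(1), of twist] twist_in_A twist_of_int[of 0] I_0 by simp

definition expand :: "real \<Rightarrow> real" where
  "expand x = twist (N * x)"

lemma expand_mono: "strict_mono expand"
  using twist_mono n_ge_3 by (simp add: expand_def strict_mono_def)

lemma expand_pow_shift:
  "(expand ^^ k) (x + (N - 1) * of_int j) = (expand ^^ k) x + (N - 1) * of_int j * N ^ k"
proof (induction k)
  case (Suc k)
  have "(expand ^^ Suc k) (x + (N - 1) * of_int j) = twist (N * (expand ^^ k) (x + (N - 1) * of_int j))"
    by (simp add: expand_def)
  also have "\<dots> = twist (N * (expand ^^ k) x + period * of_int (j * int n ^ k))"
    unfolding Suc by (simp add: algebra_simps)
  also have "\<dots> = (expand ^^ Suc k) x + (N - 1) * of_int j * N ^ Suc k"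
    unfolding twist_shift by (simp add: expand_def algebra_simps)
  finally show ?case .
qed simp

lemma expand_pow_of_int: "(expand ^^ k) (of_int i) = N ^ k * of_int i"
proof (induction k)
  case (Suc k)
  have "(expand ^^ Suc k) (of_int i) = twist (of_int (int n ^ Suc k * i))"
    by (simp add: Suc expand_def mult.assoc)
  then show ?case
    by (simp only: twist_of_int) simp
qed simp

text \<open>The series telescopes: \<open>exotic x\<close> is the limit of \<open>n\<^sup>-\<^sup>k (expand\<^sup>k x)\<close>, the unique semiconjugacy at bounded
  distance from the identity from \<open>expand\<close> to multiplication by \<open>n\<close>. Its terms are at most \<open>n\<^sup>-\<^sup>k\<^sup>-\<^sup>1\<close>
  because \<open>twist\<close> moves no point by more than 1.\<close>

definition exotic :: "real \<Rightarrow> real" where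
  "exotic x = x + (\<Sum>k. (expand ^^ Suc k) x / N ^ Suc k - (expand ^^ k) x / N ^ k)"

lemma exotic_uniform_limit: "uniform_limit UNIV (\<lambda>k x. (expand ^^ k) x / N ^ k) exotic sequentially"
proof -
  define t where "t k x = (expand ^^ Suc k) x / N ^ Suc k - (expand ^^ k) x / N ^ k" for k x
  have "norm (t k x) \<le> (1 / N) ^ Suc k" for k x
  proof -
    have "t k x = (twist (N * (expand ^^ k) x) - N * (expand ^^ k) x) / N ^ Suc k"
      using n_ge_3 by (simp add: t_def expand_def field_simps)
    then have "norm (t k x) = \<bar>twist (N * (expand ^^ k) x) - N * (expand ^^ k) x\<bar> / N ^ Suc k"
      by (simp add: abs_divide abs_mult power_abs)
    also have "\<dots> \<le> 1 / N ^ Suc k"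
      using n_ge_3 by (intro divide_right_mono twist_near) simp
    finally show ?thesis
      by (simp add: power_one_over)
  qed
  moreover have "summable (\<lambda>k. (1 / N) ^ Suc k)"
    using n_ge_3 summable_geometric[of "1 / N"] by (subst summable_Suc_iff) simp
  ultimately have "uniform_limit UNIV (\<lambda>k x. \<Sum>i<k. t i x) (\<lambda>x. \<Sum>i. t i x) sequentially"
    by (rule Weierstrass_m_test)
  then have "uniform_limit UNIV (\<lambda>k x. x + (\<Sum>i<k. t i x)) (\<lambda>x. x + (\<Sum>i. t i x)) sequentially"
    by (intro uniform_limit_intros)
  moreover have "x + (\<Sum>i<k. t i x) = (expand ^^ k) x / N ^ k" for k x
    unfolding t_def by (subst sum_lessThan_telescope) simp
  ultimately show ?thesis
    by (simp add: t_def exotic_def[abs_def])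
qed

lemma exotic_LIMSEQ: "(\<lambda>k. (expand ^^ k) x / N ^ k) \<longlonglongrightarrow> exotic x"
  using tendsto_uniform_limitI[OF exotic_uniform_limit] by simp

lemma exotic_eqI: "(\<lambda>k. (expand ^^ k) x / N ^ k) \<longlonglongrightarrow> y \<Longrightarrow> exotic x = y"
  using exotic_LIMSEQ LIMSEQ_unique by blast

lemma exotic_expand: "exotic (expand x) = N * exotic x"
proof (rule exotic_eqI)
  have "(\<lambda>k. N * ((expand ^^ Suc k) x / N ^ Suc k)) \<longlonglongrightarrow> N * exotic x"
    using exotic_LIMSEQ[of x] by (intro tendsto_mult_left) (rule LIMSEQ_Suc)
  then show "(\<lambda>k. (expand ^^ k) (expand x) / N ^ k) \<longlonglongrightarrow> N * exotic x"
    using n_ge_3 by (simp add: funpow_Suc_right del: funpow.simps)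
qed

lemma exotic_shift: "exotic (x + (N - 1) * of_int j) = exotic x + (N - 1) * of_int j"
proof (rule exotic_eqI)
  have "(\<lambda>k. (expand ^^ k) x / N ^ k + (N - 1) * of_int j) \<longlonglongrightarrow> exotic x + (N - 1) * of_int j"
    using exotic_LIMSEQ[of x] by (intro tendsto_intros)
  then show "(\<lambda>k. (expand ^^ k) (x + (N - 1) * of_int j) / N ^ k) \<longlonglongrightarrow> exotic x + (N - 1) * of_int j"
    using n_ge_3 by (simp add: expand_pow_shift add_divide_distrib)
qed

lemma exotic_of_int: "exotic (of_int i) = of_int i"
  using n_ge_3 by (intro exotic_eqI) (simp add: expand_pow_of_int)

lemma exotic_le: "x \<le> y \<Longrightarrow> exotic x \<le> exotic y"
proof -
  assume xy: "x \<le> y"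
  have "(expand ^^ k) x \<le> (expand ^^ k) y" for k
    by (induction k) (use xy strict_mono_less_eq[OF expand_mono] in auto)
  then show ?thesis
    using n_ge_3 by (intro LIMSEQ_le[OF exotic_LIMSEQ exotic_LIMSEQ]) (auto intro!: divide_right_mono exI[of _ 0])
qed

lemma exotic_at_integers: "exotic 0 = 0" "exotic 1 = 1" "exotic (numeral w) = numeral w" "exotic N = N" "exotic period = period"
  using exotic_of_int[of 0] exotic_of_int[of 1] exotic_of_int[of "numeral w"] exotic_of_int[of "int n"]
    exotic_of_int[of "int n * (int n - 1)"] by simp_all

lemma exotic_scale: "twist (N * x) = N * x \<Longrightarrow> exotic (N * x) = N * exotic x"
  using exotic_expand[of x] by (simp add: expand_def)

lemma exotic_surj: "surj exotic"
  unfolding surj_def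
proof
  fix y :: real
  have cont: "continuous_on UNIV exotic"
  proof (rule uniform_limit_theorem[OF _ exotic_uniform_limit])
    have "continuous_on UNIV (expand ^^ k)" for k
    proof (induction k)
      case (Suc k)
      have "surj twist"
        using A_carrierD(2)[OF twist_in_A] .
      then have "continuous_on UNIV twist"
        using strict_mono_surj_continuous twist_mono by blast
      then have "continuous_on UNIV (\<lambda>x. twist (N * (expand ^^ k) x))"
        by (rule continuous_on_compose2) (auto intro!: continuous_intros Suc)
      then show ?case
        by (simp add: expand_def[symmetric] o_def)
    qed simp
    then show "\<forall>\<^sub>F k in sequentially. continuous_on UNIV (\<lambda>x. (expand ^^ k) x / N ^ k)"
      using n_ge_3 by (intro always_eventually allI continuous_intros) auto
  qed simp
  have "of_int \<lfloor>y\<rfloor> \<le> y" "y \<le> of_int (\<lfloor>y\<rfloor> + 1)"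
    using floor_correct[of y] by simp_all
  then have "\<exists>x\<ge>of_int \<lfloor>y\<rfloor>. x \<le> of_int (\<lfloor>y\<rfloor> + 1) \<and> exotic x = y"
    by (intro IVT' continuous_on_subset[OF cont]) (simp_all only: exotic_of_int, simp_all)
  then show "\<exists>x. y = exotic x"
    by blast
qed

lemma bump_pieces:
  "1 \<le> x \<Longrightarrow> x \<le> 1 + 1 / N - 1 / (N * N) \<Longrightarrow> bump x = N * x + (1 - N)"
  "1 + 1 / N - 1 / (N * N) \<le> x \<Longrightarrow> x \<le> 1 + 1 / N \<Longrightarrow> bump x = x + (1 - 2 / N + 1 / (N * N))"
  "1 + 1 / N \<le> x \<Longrightarrow> x \<le> 2 \<Longrightarrow> bump x = x / N + (2 - 2 / N)"
proof -
  define r q where "r = 1 / N" and "q = 1 / (N * N)"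
  have rq: "0 < q" "q < r" "r < 1" "x / N = x * r" "1 / N = r" "2 / N = 2 * r" "1 / (N * N) = q" "r * r = q"
    "N * r = 1" "N * q = r" for x
    using n_ge_3 by (simp_all add: r_def q_def field_simps)
  have bump_eq: "bump x = (if x \<le> 1 then x else if x \<le> 1 + r - q then N * x + (1 - N)
      else if x \<le> 1 + r then x + (1 - 2 * r + q) else if x \<le> 2 then x * r + (2 - 2 * r) else x)"
    unfolding bump_def by (simp only: rq mult_1_left)
  show "bump x = N * x + (1 - N)" if "1 \<le> x" "x \<le> 1 + 1 / N - 1 / (N * N)"
    using that unfolding bump_eq rq by (cases "x = 1") simp_all
  have "N * (1 + r - q) = N + 1 - r"
    by (simp add: right_diff_distrib distrib_left rq)
  then show "bump x = x + (1 - 2 / N + 1 / (N * N))" if "1 + 1 / N - 1 / (N * N) \<le> x" "x \<le> 1 + 1 / N"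
    using that rq(1-3) unfolding bump_eq rq by (cases "x = 1 + r - q") simp_all
  have "(1 + r) * r = r + q"
    by (simp add: distrib_right rq)
  then show "bump x = x / N + (2 - 2 / N)" if "1 + 1 / N \<le> x" "x \<le> 2"
    using that rq(1-3) unfolding bump_eq rq by (cases "x = 1 + r") simp_all
qed

text \<open>On the interval \<open>[1, 2]\<close> of type 1 no twisting happens at the next level, so \<open>exotic\<close> commutes with
  the dilations at both ends; on each of its pieces \<open>bump\<close> is a word in these two.\<close>

lemma exotic_bump:
  assumes x: "1 \<le> x" "x \<le> 2"
  shows "exotic (bump x) = bump (exotic x)"
proof -
  have N: "N > 0" "N \<noteq> 0"
    using n_ge_3 by simp_all
  have "exotic (N * t) = N * exotic t" if "1 \<le> t" "t \<le> 2" for t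
  proof (rule exotic_scale, rule twist_fixed_base)
    have "N * 1 \<le> N * t" "N * t \<le> N * 2"
      using that n_ge_3 by (intro mult_left_mono; simp)+
    then show "0 \<le> N * t" "N * t \<le> period" "N * t \<notin> {1<..<2}"
      unfolding greaterThanLessThan_iff using period_ge n_ge_3 by linarith+
  qed
  then have D1: "exotic (N * t + (1 - N)) = N * exotic t + (1 - N)"
    and D2: "exotic (N * t + 2 * (1 - N)) = N * exotic t + 2 * (1 - N)" if "1 \<le> t" "t \<le> 2" for t
    using exotic_shift[of "N * t" "-1"] exotic_shift[of "N * t" "-2"] that by (simp_all add: algebra_simps)
  define c where "c = 1 + 1 / N - 1 / (N * N)"
  define d where "d = 1 + 1 / N"
  have order: "1 \<le> c" "c \<le> d" "d \<le> 2" "1 \<le> 2 - 1 / N" "2 - 1 / N \<le> 2" "1 \<le> d" "c \<le> 2"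
  proof -
    have "0 < 1 / (N * N)" "1 / (N * N) < 1 / N" "1 / N < 1"
      using n_ge_3 by (simp_all add: field_simps)
    then show "1 \<le> c" "c \<le> d" "d \<le> 2" "1 \<le> 2 - 1 / N" "2 - 1 / N \<le> 2" "1 \<le> d" "c \<le> 2"
      unfolding c_def d_def by linarith+
  qed
  have "N * exotic (2 - 1 / N) + 2 * (1 - N) = 1"
    using D2[OF order(4,5)] N exotic_at_integers(2) by (simp add: algebra_simps)
  then have e: "exotic (2 - 1 / N) = 2 - 1 / N"
    using N by (simp add: field_simps)
  have Nc: "N * c + (1 - N) = 2 - 1 / N"
    using N by (simp add: c_def field_simps)
  then have "N * exotic c + (1 - N) = N * c + (1 - N)"
    using D1[OF order(1,7)] e by metis
  then have "N * exotic c = N * c"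
    by linarith
  then have c: "exotic c = c"
    using N(2) by (rule mult_left_cancel[THEN iffD1, rotated])
  have Nd: "N * d + (1 - N) = 2"
    using N by (simp add: d_def field_simps)
  then have "N * exotic d + (1 - N) = N * d + (1 - N)"
    using D1[OF order(6,3)] exotic_at_integers(3) by metis
  then have "N * exotic d = N * d"
    by linarith
  then have d: "exotic d = d"
    using N(2) by (rule mult_left_cancel[THEN iffD1, rotated])
  consider "x \<le> c" | "c \<le> x" "x \<le> d" | "d \<le> x"
    by linarith
  then show ?thesis
  proof cases
    case 1
    then have "1 \<le> exotic x" "exotic x \<le> c"
      using exotic_le[OF x(1)] exotic_le[of x c] c by (simp_all add: exotic_at_integers)
    then show ?thesis
      using 1 x D1[OF x] bump_pieces(1) by (simp add: c_def)
  next
    case 2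
    have xe: "c \<le> exotic x" "exotic x \<le> d"
      using exotic_le[OF 2(1)] exotic_le[OF 2(2)] c d by simp_all
    \<comment> \<open>With the dilations \<open>D\<^sub>1\<close>, \<open>D\<^sub>2\<close> at the ends, \<open>bump = D\<^sub>2\<^sup>-\<^sup>1 \<circ> D\<^sub>1\<^sup>-\<^sup>1 \<circ> D\<^sub>2 \<circ> D\<^sub>1\<close> on this piece,
      and all intermediate points stay in \<open>[1, 2]\<close>.\<close>
    define y z where "y = N * x + (1 - N)" and "z = N * y + 2 * (1 - N)"
    have "N * c \<le> N * x" "N * x \<le> N * d"
      using 2 N by simp_all
    then have y: "2 - 1 / N \<le> y" "y \<le> 2"
      unfolding y_def using Nc Nd by linarith+
    have "N * (2 - 1 / N) \<le> N * y" "N * y \<le> N * 2"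
      using y N by simp_all
    then have z: "1 \<le> z" "z \<le> 2"
      using N by (simp_all add: z_def right_diff_distrib)
    define u where "u = (z - (1 - N)) / N"
    have u: "1 \<le> u" "u \<le> 2" "z = N * u + (1 - N)"
      using z N n_ge_3 by (simp_all add: u_def field_simps)
    define v where "v = (u - 2 * (1 - N)) / N"
    have v: "1 \<le> v" "v \<le> 2" "u = N * v + 2 * (1 - N)"
      using u N n_ge_3 by (simp_all add: v_def field_simps)
    have "v = bump x"
      unfolding bump_pieces(2)[OF 2[unfolded c_def d_def]] v_def u_def z_def y_def
      using N by (simp add: field_simps)
    have ey: "exotic y = N * exotic x + (1 - N)"
      unfolding y_def by (rule D1[OF x])
    have "exotic z = N * exotic y + 2 * (1 - N)"
      unfolding z_def by (rule D2) (use y order in auto)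
    moreover have "exotic z = N * exotic u + (1 - N)"
      unfolding u(3) by (rule D1[OF u(1,2)])
    ultimately have "N * exotic u = N * exotic y + (1 - N)"
      by (simp only:) (simp add: algebra_simps)
    then have eu: "exotic u = exotic y + 1 / N - 1"
      using N by (simp add: field_simps)
    have "exotic u = N * exotic v + 2 * (1 - N)"
      unfolding v(3) by (rule D2[OF v(1,2)])
    then have "exotic v = (exotic u - 2 * (1 - N)) / N"
      using N by (simp add: field_simps)
    also have "\<dots> = exotic x + (1 - 2 / N + 1 / (N * N))"
      unfolding eu ey using N by (simp add: field_simps)
    also have "\<dots> = bump (exotic x)"
      using bump_pieces(2)[OF xe[unfolded c_def d_def]] by simp
    finally show ?thesis
      using \<open>v = bump x\<close> by simp
  next
    case 3
    then have xe: "d \<le> exotic x" "exotic x \<le> 2"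
      using exotic_le[OF 3] exotic_le[OF x(2)] d by (simp_all add: exotic_at_integers)
    define v where "v = x / N + (2 - 2 / N)"
    have v: "1 \<le> v" "v \<le> 2" "x = N * v + 2 * (1 - N)"
      using x N n_ge_3 by (simp_all add: v_def field_simps)
    have "exotic x = N * exotic v + 2 * (1 - N)"
      by (subst v(3)) (rule D2[OF v(1,2)])
    then have "exotic v = exotic x / N + (2 - 2 / N)"
      using N by (simp add: field_simps)
    then show ?thesis
      using bump_pieces(3)[of x] bump_pieces(3)[of "exotic x"] 3 x xe by (simp add: d_def v_def)
  qed
qed

text \<open>By periodicity it suffices to compare the two sides on one period, where \<open>twist\<close> is supported on \<open>[1, 2]\<close>.\<close>

lemma exotic_twist: "exotic (twist x) = twist (exotic x)"
proof -
  define j where "j = \<lfloor>x / period\<rfloor>"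
  define y where "y = x - period * of_int j"
  have period: "period > 0"
    using n_ge_3 by simp
  have "of_int j \<le> x / period" "x / period \<le> of_int (j + 1)"
    using floor_correct[of "x / period"] by (simp_all add: j_def)
  then have y: "0 \<le> y" "y \<le> period"
    using period by (simp_all only: pos_le_divide_eq pos_divide_le_eq y_def) (simp_all add: algebra_simps)
  have shift: "exotic (t + period * of_int j) = exotic t + period * of_int j" for t
    using exotic_shift[of t "int n * j"] by (simp add: algebra_simps)
  have ye: "0 \<le> exotic y" "exotic y \<le> period"
    using exotic_le[OF y(1)] exotic_le[OF y(2)] by (simp_all only: exotic_at_integers)
  have "exotic (twist y) = twist (exotic y)"
  proof (cases "y \<in> {1..2}")
    case True
    then show ?thesis
      using exotic_bump[of y] y ye by (simp add: twist_base)
  next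
    case False
    then have "exotic y \<le> 1 \<or> 2 \<le> exotic y"
      using exotic_le[of y 1] exotic_le[of 2 y] by (auto simp: exotic_at_integers)
    then have "twist (exotic y) = exotic y"
      using ye by (intro twist_fixed_base) auto
    moreover have "twist y = y"
      using False y by (intro twist_fixed_base) auto
    ultimately show ?thesis
      by simp
  qed
  then have "exotic (twist (y + period * of_int j)) = twist (exotic (y + period * of_int j))"
    by (simp only: twist_shift shift)
  then show ?thesis
    by (simp add: y_def)
qed

text \<open>In other words \<open>exotic\<close> conjugates \<open>x \<mapsto> n x\<close> to \<open>twist\<^sup>-\<^sup>1 \<circ> (x \<mapsto> n x)\<close>.\<close>

lemma twist_exotic_scale: "twist (exotic (N * x)) = N * exotic x"
  using exotic_expand[of x] by (simp add: expand_def exotic_twist)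

text \<open>If two points had the same image, then so would their multiples by all powers of \<open>n\<close>, again because of
  \<open>twist_exotic_scale\<close>; but points more than 2 apart are separated by integers, which are fixed.\<close>

lemma exotic_mono: "strict_mono exotic"
proof (rule strict_monoI)
  have inj: "\<not> x < y" if "exotic x = exotic y" for x y
  proof
    assume "x < y"
    have scaled: "exotic (N ^ k * x) = exotic (N ^ k * y)" for k
    proof (induction k)
      case (Suc k)
      have "twist (exotic (N * (N ^ k * x))) = twist (exotic (N * (N ^ k * y)))"
        by (simp only: twist_exotic_scale Suc)
      then show ?case
        using strict_mono_eq[OF twist_mono] by (simp add: mult.assoc)
    qed (use that in simp)
    obtain k where k: "2 / (y - x) < N ^ k"
      using real_arch_pow[of N] n_ge_3 by auto
    define a b where "a = N ^ k * x" and "b = N ^ k * y"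
    have ab: "b - a > 2"
      using k \<open>x < y\<close> by (simp add: a_def b_def pos_divide_less_eq right_diff_distrib)
    define i where "i = \<lceil>a\<rceil>"
    have "a \<le> of_int i" "of_int i + 1 \<le> b"
      using ab by (simp_all add: i_def) linarith
    then have "exotic a \<le> of_int i" "of_int (i + 1) \<le> exotic b"
      using exotic_le[of a "of_int i"] exotic_le[of "of_int (i + 1)" b] unfolding exotic_of_int by simp_all
    then show False
      using scaled[of k] by (simp add: a_def b_def)
  qed
  fix x y :: real assume "x < y"
  then show "exotic x < exotic y"
    using exotic_le[of x y] inj[of x y] by force
qed

section \<open>The exotic automorphism has infinite order modulo Aut(A)\<close>

lemma exotic_inv: "inver exotic (exotic x) = x" "exotic (inver exotic x) = x"
  using inver_simps[OF exotic_mono exotic_surj] .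

lemma scaling_in_B: "(\<lambda>x. N * x) \<in> B"
  using scaling_translation_in_B(1)[of 1] by simp

lemma translation_in_B: "(\<lambda>x. x + (N - 1)) \<in> B"
  using scaling_translation_in_B(2)[of 1] by simp

lemma exotic_conj_in_B:
  assumes f: "f \<in> B"
  shows "conj_by exotic f \<in> B" "conj_by (inver exotic) f \<in> B"
proof -
  note incr = exotic_mono exotic_surj exotic_of_int
  note incr' = strict_mono_inv[OF incr(1,2)]
  have inv_inv: "inver (inver exotic) = exotic"
    using incr(1,2) by (intro inv_inv_eq) (simp add: bij_def strict_mono_imp_inj_on)
  have K'_int: "inver exotic (of_int i) = of_int i" for i
    using exotic_inv(1)[of "of_int i"] by (simp add: incr(3))
  have GA: "twist \<in> A"
    using twist_in_A .
  have "conj_by exotic (\<lambda>x. N * x) = inver twist \<circ> (\<lambda>x. N * x)"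
  proof
    fix x
    have "twist (conj_by exotic (\<lambda>x. N * x) x) = N * x"
      by (simp add: conj_by_def twist_exotic_scale exotic_inv)
    then show "conj_by exotic (\<lambda>x. N * x) x = (inver twist \<circ> (\<lambda>x. N * x)) x"
      using inver_simps(1)[OF A_carrierD(1,2)[OF GA]] by (metis comp_apply)
  qed
  then have M: "conj_by exotic (\<lambda>x. N * x) \<in> B"
    using comp_in_B[OF scaling_in_B inv_in_B[OF twist_in_B]] by simp
  have "conj_by (inver exotic) (\<lambda>x. N * x) = twist \<circ> (\<lambda>x. N * x)"
  proof
    fix x
    have "N * exotic x = exotic (expand x)"
      by (simp add: exotic_expand)
    then show "conj_by (inver exotic) (\<lambda>x. N * x) x = (twist \<circ> (\<lambda>x. N * x)) x"
      by (simp add: conj_by_def inv_inv exotic_inv expand_def)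
  qed
  then have M': "conj_by (inver exotic) (\<lambda>x. N * x) \<in> B"
    using comp_in_B[OF scaling_in_B twist_in_B] by simp
  have shift: "exotic (x + (N - 1)) = exotic x + (N - 1)" for x
    using exotic_shift[of x 1] by simp
  then have "conj_by exotic (\<lambda>x. x + (N - 1)) = (\<lambda>x. x + (N - 1))"
    by (simp add: conj_by_def fun_eq_iff exotic_inv)
  then have T: "conj_by exotic (\<lambda>x. x + (N - 1)) \<in> B"
    using translation_in_B by simp
  have "conj_by (inver exotic) (\<lambda>x. x + (N - 1)) = (\<lambda>x. x + (N - 1))"
    by (simp only: conj_by_def fun_eq_iff inv_inv comp_apply shift[symmetric] exotic_inv simp_thms)
  then have T': "conj_by (inver exotic) (\<lambda>x. x + (N - 1)) \<in> B"
    using translation_in_B by simp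
  show "conj_by exotic f \<in> B"
    by (rule conj_in_B_of_generators[OF incr M T M' T' f])
  show "conj_by (inver exotic) f \<in> B"
    by (rule conj_in_B_of_generators[OF incr' K'_int M' T' _ _ f]) (simp_all only: inv_inv M T)
qed

abbreviation L where "L m \<equiv> exotic ^^ m"

lemma exotic_pow_mono: "strict_mono (L m)" "surj (L m)"
proof -
  show "strict_mono (L m)"
    by (induction m) (use exotic_mono in \<open>auto simp: strict_mono_def\<close>)
  show "surj (L m)"
  proof (induction m)
    case (Suc m)
    then show ?case
      using comp_surj[OF Suc exotic_surj] by simp
  qed simp
qed

lemma exotic_pow_of_int: "L m (of_int i) = of_int i"
  by (induction m) (simp_all add: exotic_of_int)

lemma exotic_pow_inv: "inver (L m) (L m x) = x" "L m (inver (L m) x) = x"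
  using inver_simps[OF exotic_pow_mono] .

lemma inver_exotic_pow_Suc: "inver (L (Suc m)) = inver (L m) \<circ> inver exotic"
proof
  fix x
  have "x = L (Suc m) ((inver (L m) \<circ> inver exotic) x)"
    by (simp add: exotic_pow_inv exotic_inv)
  then show "inver (L (Suc m)) x = (inver (L m) \<circ> inver exotic) x"
    by (metis exotic_pow_inv(1))
qed

lemma conj_exotic_pow_Suc: "conj_by (L (Suc m)) f = conj_by exotic (conj_by (L m) f)"
  unfolding conj_by_def inver_exotic_pow_Suc by (simp add: fun_eq_iff)

lemma conj_exotic_pow_in_B: "f \<in> B \<Longrightarrow> conj_by (L m) f \<in> B"
proof (induction m)
  case 0
  then show ?case
    by (simp add: conj_by_def)
next
  case (Suc m)
  then show ?case
    unfolding conj_exotic_pow_Suc by (intro exotic_conj_in_B(1))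
qed

lemma conj_exotic_pow_onto_B: "f \<in> B \<Longrightarrow> \<exists>g\<in>B. f = conj_by (L m) g"
proof (induction m arbitrary: f)
  case 0
  then show ?case
    by (intro bexI[of _ f]) (simp_all add: conj_by_def)
next
  case (Suc m)
  have inv_inv: "inver (inver exotic) = exotic"
    using exotic_mono exotic_surj by (intro inv_inv_eq) (simp add: bij_def strict_mono_imp_inj_on)
  obtain g where g: "g \<in> B" "conj_by (inver exotic) f = conj_by (L m) g"
    using Suc.IH[OF exotic_conj_in_B(2)[OF Suc.prems]] by blast
  have "f = conj_by exotic (conj_by (inver exotic) f)"
    by (simp add: conj_by_def fun_eq_iff inv_inv exotic_inv)
  then show ?case
    using g by (intro bexI[of _ g]) (simp_all only: conj_exotic_pow_Suc)
qed

text \<open>The analogue of \<open>twist_exotic_scale\<close> for powers; it holds because \<open>twist\<close> and \<open>exotic\<close> commute.\<close>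

lemma twist_pow_exotic_pow_scale: "(twist ^^ m) (L m (N * x)) = N * L m x"
proof (induction m arbitrary: x)
  case (Suc m)
  have commute: "twist (L k y) = L k (twist y)" for k y
    by (induction k) (simp_all add: exotic_twist[symmetric])
  have "(twist ^^ Suc m) (L (Suc m) (N * x)) = (twist ^^ m) (twist (L m (exotic (N * x))))"
    by (simp add: funpow_swap1)
  also have "\<dots> = (twist ^^ m) (L m (N * exotic x))"
    by (simp only: commute twist_exotic_scale)
  also have "\<dots> = N * L (Suc m) x"
    by (simp add: Suc.IH funpow_swap1)
  finally show ?case .
qed simp

text \<open>The first part of any unit interval is not twisted, so at integers \<open>exotic\<close> is self-similar with ratio \<open>n\<close>.\<close>

lemma exotic_contract:
  assumes "0 \<le> s" "s \<le> 1"
  shows "exotic (of_int i + s / N) = of_int i + (exotic (of_int i + s) - of_int i) / N"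
proof -
  have N: "N > 0"
    using n2 by simp
  have eq: "N * (of_int i + s / N) = N * of_int i + s"
    using N by (simp add: distrib_left)
  have "twist (N * (of_int i + s / N)) = N * (of_int i + s / N)"
    unfolding eq by (rule twist_fixed_first_child[of i]) (use assms in auto)
  then have "exotic (N * of_int i + s) = N * exotic (of_int i + s / N)"
    using exotic_scale eq by metis
  moreover have "exotic (of_int i + s + (N - 1) * of_int i) = exotic (of_int i + s) + (N - 1) * of_int i"
    by (rule exotic_shift)
  then have "exotic (N * of_int i + s) = exotic (of_int i + s) + (N - 1) * of_int i"
    by (simp add: algebra_simps)
  ultimately show ?thesis
    using N by (simp add: field_simps)
qed

lemma exotic_pow_unit:
  assumes "0 \<le> s" "s \<le> 1"
  shows "of_int i \<le> L m (of_int i + s)" "L m (of_int i + s) \<le> of_int i + 1"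
  using strict_mono_less_eq[OF exotic_pow_mono(1)[of m], of "of_int i" "of_int i + s"] exotic_pow_of_int[of m i]
    strict_mono_less_eq[OF exotic_pow_mono(1)[of m], of "of_int i + s" "of_int (i + 1)"] exotic_pow_of_int[of m "i + 1"] assms
  by simp_all

lemma exotic_pow_contract:
  assumes "0 \<le> s" "s \<le> 1"
  shows "L m (of_int i + s / N) = of_int i + (L m (of_int i + s) - of_int i) / N"
proof (induction m)
  case (Suc m)
  define t where "t = L m (of_int i + s) - of_int i"
  have t: "0 \<le> t" "t \<le> 1"
    using exotic_pow_unit[OF assms, where i = i and m = m] by (simp_all add: t_def)
  have "L (Suc m) (of_int i + s / N) = exotic (of_int i + t / N)"
    by (simp add: Suc t_def)
  also have "\<dots> = of_int i + (L (Suc m) (of_int i + s) - of_int i) / N"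
    by (simp add: exotic_contract[OF t]) (simp add: t_def)
  finally show ?case .
qed simp

text \<open>The conjugate \<open>g\<close> of \<open>x \<mapsto> x + 1\<close> inherits self-similarity at the integers. As an element of \<open>A\<close> it is also
  affine just to the right of each integer, and a self-similar map with an affine germ is affine on the whole unit interval;
  its values at the ends then leave only the translation by 1.\<close>

lemma conj_translation_commutes:
  assumes g: "g \<in> A" and g_eq: "\<And>x. g (L m x) = L m (x + 1)"
  shows "L m (x + 1) = L m x + 1"
proof -
  define i where "i = \<lfloor>L m x\<rfloor>"
  define d where "d s = g (of_int i + s) - of_int (i + 1)" for s
  have N: "N > 1"
    using n2 by simp
  have d_contract: "d (s / N) = d s / N" if s: "0 \<le> s" "s \<le> 1" for s
  proof -
    obtain v where v: "of_int i + s = L m v"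
      using exotic_pow_mono(2) by (rule surjE)
    define r where "r = v - of_int i"
    have "L m (of_int i) \<le> L m v" "L m v \<le> L m (of_int (i + 1))"
      unfolding exotic_pow_of_int v[symmetric] using s by simp_all
    then have r: "0 \<le> r" "r \<le> 1" and vr: "v = of_int i + r"
      using strict_mono_less_eq[OF exotic_pow_mono(1)] by (auto simp: r_def)
    have "of_int i + s / N = L m (of_int i + r / N)"
      using exotic_pow_contract[OF r, where m = m and i = i] v vr by simp
    then have "g (of_int i + s / N) = L m (of_int (i + 1) + r / N)"
      using g_eq[of "of_int i + r / N"] by (simp add: add_ac)
    also have "\<dots> = of_int (i + 1) + (L m (of_int (i + 1) + r) - of_int (i + 1)) / N"
      by (rule exotic_pow_contract[OF r])
    also have "L m (of_int (i + 1) + r) = g (of_int i + s)"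
      using g_eq[of v] v vr by (simp add: add_ac)
    finally show ?thesis
      by (simp add: d_def)
  qed
  have d_pow: "d s = N ^ j * d (s / N ^ j)" if s: "0 \<le> s" "s \<le> 1" for s j
  proof (induction j)
    case (Suc j)
    have "s / N ^ j \<le> s / 1"
      using s N by (intro divide_left_mono) auto
    then have "0 \<le> s / N ^ j" "s / N ^ j \<le> 1"
      using s N by (simp, linarith)
    then have "d (s / N ^ j / N) = d (s / N ^ j) / N"
      by (rule d_contract)
    then show ?case
      using Suc N by (simp add: field_simps)
  qed simp
  obtain k where "affine_germ g (of_int i) (at_right (of_int i)) k"
    using A_carrier_affine_germs[OF g] by blast
  then obtain e where e: "e > 0" "\<And>y. of_int i < y \<Longrightarrow> y < of_int i + e \<Longrightarrow>
      g y = g (of_int i) + N powi k * (y - of_int i)"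
    unfolding affine_germ_def by (rule eventually_at_right_interval) blast
  have gi: "g (of_int j) = of_int (j + 1)" for j
    using g_eq[of "of_int j"] exotic_pow_of_int[of m j] exotic_pow_of_int[of m "j + 1"] by simp
  have linear: "d s = N powi k * s" if s: "0 < s" "s \<le> 1" for s
  proof -
    obtain j where j: "s / e < N ^ j"
      using real_arch_pow[OF N] by blast
    then have small: "s / N ^ j < e"
      using e(1) N by (simp add: field_simps)
    have "d (s / N ^ j) = N powi k * (s / N ^ j)"
      using e(2)[of "of_int i + s / N ^ j"] small s N gi[of i] by (simp add: d_def)
    then show ?thesis
      using d_pow[of s j] s N by simp
  qed
  have "d 1 = 1"
    using gi[of "i + 1"] by (simp add: d_def)
  then have k: "N powi k = 1"
    using linear[of 1] by simp
  define s where "s = L m x - of_int i"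
  have s: "0 \<le> s" "s \<le> 1"
    by (simp_all add: s_def i_def) linarith
  have "d s = s"
    using linear[of s] s k gi[of i] by (cases "s = 0") (auto simp: d_def)
  then show ?thesis
    using g_eq[of x] by (simp add: d_def s_def)
qed

text \<open>Once the power of \<open>exotic\<close> commutes with integer translations, comparing \<open>twist_pow_exotic_pow_scale\<close> at \<open>x\<close> and at
  \<open>x + 1\<close> shows that \<open>twist\<^sup>m\<close> commutes with \<open>y \<mapsto> y + n\<close>. This fails at \<open>3/2\<close>: this point is moved by
  \<open>twist\<close>, but \<open>3/2 + n\<close> lies outside the support.\<close>

lemma conj_translation_not_in_A:
  assumes "g \<in> A" "\<And>x. g (L m x) = L m (x + 1)"
  shows "m = 0"
proof (rule ccontr)
  assume m: "m \<noteq> 0"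
  have N: "N \<ge> 3"
    using n2 by simp
  have step: "L m (x + 1) = L m x + 1" for x
    by (rule conj_translation_commutes[OF assms])
  have steps: "L m (x + real j) = L m x + real j" for x j
  proof (induction j)
    case (Suc j)
    then show ?case
      using step[of "x + real j"] by (simp add: add_ac)
  qed simp
  have commute: "(twist ^^ m) (y + N) = (twist ^^ m) y + N" for y
  proof -
    obtain v where v: "y = L m v"
      using exotic_pow_mono(2) by (rule surjE)
    define x where "x = v / N"
    have y: "y = L m (N * x)"
      using N by (simp add: x_def v)
    have "(twist ^^ m) (y + N) = (twist ^^ m) (L m (N * (x + 1)))"
      using steps[of "N * x" n] by (simp add: y distrib_left)
    also have "\<dots> = N * L m (x + 1)"
      by (rule twist_pow_exotic_pow_scale)
    also have "\<dots> = (twist ^^ m) y + N"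
      by (simp add: step y twist_pow_exotic_pow_scale distrib_left)
    finally show ?thesis .
  qed
  define y :: real where "y = 3 / 2"
  have period: "N * (N - 1) \<ge> 2 * N"
    by (rule period_ge)
  have "twist (y + N) = y + N"
  proof (rule twist_fixed_base)
    show "0 \<le> y + N" "y + N \<le> N * (N - 1)" "y + N \<notin> {1<..<2}"
      unfolding y_def greaterThanLessThan_iff using period N by linarith+
  qed
  then have "(twist ^^ k) (y + N) = y + N" for k
    by (induction k) simp_all
  then have "(twist ^^ m) y = y"
    using commute[of y] by simp
  moreover have "y < twist y"
  proof -
    have "y \<le> N * (N - 1)"
      unfolding y_def using period N by linarith
    then show ?thesis
      using bump_greater[of y] twist_base[of y] by (simp add: y_def)
  qed
  then have "y < (twist ^^ Suc k) y" for k
  proof (induction k)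
    case (Suc k)
    have "twist y < twist ((twist ^^ Suc k) y)"
      using strict_mono_less[OF twist_mono] Suc by simp
    then show ?case
      using \<open>y < twist y\<close> by simp
  qed simp
  ultimately show False
    using m by (metis less_irrefl not0_implies_Suc)
qed

definition exotic_aut :: "(real \<Rightarrow> real) \<Rightarrow> real \<Rightarrow> real" where
  "exotic_aut = restrict (conj_by exotic) B"

lemma conj_exotic_comp: "conj_by exotic (f \<circ> g) = conj_by exotic f \<circ> conj_by exotic g"
  by (simp add: conj_by_def fun_eq_iff exotic_inv)

lemma exotic_aut_in_auto: "exotic_aut \<in> auto (B_group n)"
proof -
  have "inj (conj_by exotic)"
  proof (rule injI)
    fix f g assume eq: "conj_by exotic f = conj_by exotic g"
    have "exotic (f x) = exotic (g x)" for x
      using fun_cong[OF eq, of "exotic x"] by (simp add: conj_by_def exotic_inv)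
    then show "f = g"
      using exotic_inv(1) by (metis ext)
  qed
  moreover have "conj_by exotic ` B = B"
    using conj_exotic_pow_in_B[of _ 1] conj_exotic_pow_onto_B[of _ 1] by auto
  ultimately have "bij_betw (conj_by exotic) B B"
    by (auto simp: bij_betw_def intro: inj_on_subset)
  then show ?thesis
    using exotic_conj_in_B(1) comp_in_B
    by (auto simp: exotic_aut_def auto_def Bij_def hom_def B_group_simps conj_exotic_comp)
qed

lemma exotic_aut_pow: "exotic_aut [^]\<^bsub>AutoGroup (B_group n)\<^esub> (m :: nat) = restrict (conj_by (L m)) B"
proof -
  interpret group "AutoGroup (B_group n)"
    by (rule group.AutoGroup[OF group_B])
  have carrier: "exotic_aut \<in> carrier (AutoGroup (B_group n))"
    using exotic_aut_in_auto by (simp add: AutoGroup_carrier)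
  show ?thesis
  proof (induction m)
    case 0
    then show ?case
      by (simp add: AutoGroup_def BijGroup_def B_group_simps conj_by_def restrict_def fun_eq_iff)
  next
    case (Suc m)
    have "exotic_aut [^]\<^bsub>AutoGroup (B_group n)\<^esub> (Suc m)
        = exotic_aut \<otimes>\<^bsub>AutoGroup (B_group n)\<^esub> exotic_aut [^]\<^bsub>AutoGroup (B_group n)\<^esub> m"
      using nat_pow_Suc2[OF carrier] .
    also have "\<dots> = compose B exotic_aut (exotic_aut [^]\<^bsub>AutoGroup (B_group n)\<^esub> m)"
      using AutoGroup_mult[OF exotic_aut_in_auto] nat_pow_closed[OF carrier, of m]
      by (simp add: AutoGroup_carrier B_group_simps)
    also have "\<dots> = restrict (conj_by (L (Suc m))) B"
      unfolding Suc conj_exotic_pow_Suc[abs_def]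
      by (auto simp: compose_def restrict_def fun_eq_iff exotic_aut_def conj_exotic_pow_in_B)
    finally show ?case .
  qed
qed

text \<open>An extension of the automorphism to \<open>A\<close> would have to send \<open>x \<mapsto> x + 1\<close> to its conjugate under the power of
  \<open>exotic\<close>, because an element of \<open>A\<close> is determined by its action on \<open>B\<close>.\<close>

lemma exotic_aut_pow_not_restriction:
  assumes "exotic_aut [^]\<^bsub>AutoGroup (B_group n)\<^esub> (m :: nat) \<in> restr_aut n ` auto (A_group n)"
  shows "m = 0"
proof -
  obtain a where a: "a \<in> auto (A_group n)" and eq: "restrict (conj_by (L m)) B = restrict a B"
    using assms by (auto simp: exotic_aut_pow restr_aut_def)
  have aB: "a b = conj_by (L m) b" if "b \<in> B" for b
    using fun_cong[OF eq, of b] that by simp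
  define s where "s x = x + (1 :: real)" for x
  have sA: "s \<in> A"
    using affine_in_A[OF Z_numeral(2), of 0] by (simp add: s_def[abs_def])
  have L_conj: "conj_by (L m) (f \<circ> g) = conj_by (L m) f \<circ> conj_by (L m) g" for f g
    by (simp add: conj_by_def fun_eq_iff exotic_pow_inv)
  have "a s = conj_by (L m) s"
  proof (rule conjugation_on_B_determines)
    have "bij s"
      using A_bij[OF sA] .
    moreover have "bij (L m)"
      using exotic_pow_mono by (simp add: bij_def strict_mono_imp_inj_on)
    ultimately show "bij (conj_by (L m) s)"
      unfolding conj_by_def by (intro bij_comp bij_imp_bij_inv)
    fix b' assume "b' \<in> B"
    then obtain b where b: "b \<in> B" "b' = conj_by (L m) b"
      using conj_exotic_pow_onto_B by blast
    define c where "c = s \<circ> b \<circ> inver s"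
    have c: "c \<in> B"
      unfolding c_def using conj_in_B[OF sA b(1)] .
    have sb: "s \<circ> b = c \<circ> s"
      using inv_comp_A(2)[OF sA] by (simp add: c_def comp_assoc)
    have bA: "b \<in> A" "c \<in> A"
      using b c B_subset_A by blast+
    have "a s \<circ> a b = a c \<circ> a s"
      using autoA_comp[OF a bA(1) sA] autoA_comp[OF a sA bA(2)] sb by simp
    moreover have "conj_by (L m) s \<circ> conj_by (L m) b = conj_by (L m) c \<circ> conj_by (L m) s"
      by (simp only: L_conj[symmetric] sb)
    ultimately show "\<exists>d. a s \<circ> b' = d \<circ> a s \<and> conj_by (L m) s \<circ> b' = d \<circ> conj_by (L m) s"
      using aB[OF b(1)] aB[OF c] b(2) by auto
  qed
  moreover have "a s \<in> A"
    using autoA_closed[OF a sA] .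
  ultimately have "conj_by (L m) s \<in> A"
    by simp
  then show "m = 0"
    by (rule conj_translation_not_in_A) (simp add: conj_by_def exotic_pow_inv s_def)
qed

lemma infinite_index:
  "infinite (rcosets\<^bsub>AutoGroup (B_group n)\<^esub> (restr_aut n ` carrier (AutoGroup (A_group n))))"
    (is "infinite (rcosets\<^bsub>?G\<^esub> ?H)")
proof
  assume fin: "finite (rcosets\<^bsub>?G\<^esub> ?H)"
  interpret group ?G
    by (rule group.AutoGroup[OF group_B])
  have H: "subgroup ?H ?G"
    by (rule restr_aut_image_subgroup)
  have x: "exotic_aut \<in> carrier ?G"
    using exotic_aut_in_auto by (simp add: AutoGroup_carrier)
  define P where "P m = exotic_aut [^]\<^bsub>?G\<^esub> (m :: nat)" for m
  have P: "P m \<in> carrier ?G" for m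
    using x by (simp add: P_def)
  have "range (\<lambda>m. ?H #>\<^bsub>?G\<^esub> P m) \<subseteq> rcosets\<^bsub>?G\<^esub> ?H"
    using P by (auto simp: RCOSETS_def)
  then have "finite (range (\<lambda>m. ?H #>\<^bsub>?G\<^esub> P m))"
    using fin by (rule finite_subset)
  then have "\<not> inj (\<lambda>m. ?H #>\<^bsub>?G\<^esub> P m)"
    using finite_imageD infinite_UNIV_nat by blast
  then obtain i j where ij: "i < j" "?H #>\<^bsub>?G\<^esub> P i = ?H #>\<^bsub>?G\<^esub> P j"
    unfolding inj_def by (metis linorder_neqE_nat)
  have "P j \<in> ?H #>\<^bsub>?G\<^esub> P i"
    using rcos_self[OF P H, of j] ij(2) by simp
  then obtain h where h: "h \<in> ?H" "P j = h \<otimes>\<^bsub>?G\<^esub> P i"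
    by (auto simp: r_coset_def)
  have "P j = P (j - i) \<otimes>\<^bsub>?G\<^esub> P i"
    using nat_pow_mult[OF x, of "j - i" i] ij(1) by (simp add: P_def)
  then have "P (j - i) = h"
    using h subgroup.mem_carrier[OF H h(1)] P by (metis right_cancel)
  then have "j - i = 0"
    using h(1) by (intro exotic_aut_pow_not_restriction) (simp add: P_def AutoGroup_carrier)
  then show False
    using ij(1) by simp
qed

end

theorem theorem6p1p6:
  fixes n :: nat
  assumes "n > 2"
  shows "(characteristic_subgroup (B_carrier n) (A_group n)
          \<and> restr_aut n \<in> hom (AutoGroup (A_group n)) (AutoGroup (B_group n)))
       \<and> (restr_aut n \<in> mon (AutoGroup (A_group n)) (AutoGroup (B_group n))
          \<and> subgroup (restr_aut n ` carrier (AutoGroup (A_group n))) (AutoGroup (B_group n)))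
       \<and> finite (rcosets\<^bsub>A_group n\<^esub> (B_carrier n))
       \<and> infinite (rcosets\<^bsub>AutoGroup (B_group n)\<^esub>
            (restr_aut n ` carrier (AutoGroup (A_group n))))"
  using characteristic_B restr_aut_hom restr_aut_mon restr_aut_image_subgroup finite_index_B
    infinite_index assms by blast

end
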